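(* Consider minimizing $f(x)=\frac1N\sum_{i=1}^Nf_i(x)$ over $\mathbb{R}^d$ by the algorithm A-DEED-GD described in the context, where each $f_i:\mathbb{R}^d\to\mathbb{R}$ is $L$-smooth and $f$ is $\mu$-strongly convex, with minimizer $x^*$. Let $\eta=\frac1L$, $c:=\sqrt{1-\sqrt{\mu/L}}$, $c<c'<1$, $s>0$, and let the quantizations at iteration $k$ be done with maximal error $s(c')^{k+1}/2$. Then: (1) For all $k\ge0$, $$\|x_k-x^*\|\le\sqrt{\frac2\mu}\cdot(c')^k\cdot\sqrt{\Delta/\gamma^{2k}+C},$$ where $\gamma=c'/c>1$, $\Delta=f(x_0)-f(x^* )+\frac\mu2\|x_0-x^*\|^2$, $$\alpha_s=\frac{s^2}{L(\gamma^2-1)}+\Delta,\qquad \beta_s=\left(\frac{3\sqrt{2/L}+5\sqrt{2/\mu}}{c(\gamma^2-1)}\right)s\gamma,\qquad C=\beta_s^2+\alpha_s+\beta_s\sqrt{\alpha_s}-\Delta .$$ (2) The number of bits communicated at each iteration $k\ge1$ is $O(Nd)$.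
   Context: $\|\cdot\|$ is the Euclidean norm. A differentiable $h$ is $L$-smooth if $|h(y)-h(x)-\langle y-x,\nabla h(x)\rangle|\le\frac L2\|x-y\|^2$ for all $x,y$; a differentiable $f$ is $\mu$-strongly convex if $f(y)-f(x)-\langle y-x,\nabla f(x)\rangle\ge\frac\mu2\|x-y\|^2$ for all $x,y$. **Network.** A star network: server $0$ is the central node and servers $i\in[N]=\{1,\dots,N\}$ are computing nodes; $f_i$ is held by server $i$. **Quantization.** An $\alpha$-encoding scheme on a set $S\subseteq\mathbb{R}^d$ consists of $\mathbf E:S\times\Xi\to\mathbb{Z}^+$ and $\mathbf D:\mathbb{Z}^+\to\mathbb{R}^d$ ($\Xi$ the set of random seeds $\xi$), with $\mathbb{E}_\xi[\mathbf D(\mathbf E(w,\xi))]=w$ and $\|\mathbf D(\mathbf E(w,\xi))-w\|\le\alpha$ for $w\in S$; its number of bits is $\mathbb{E}_\xi\lceil\log_2|\mathbf E(S,\xi)|\rceil$. $Q(w,\varepsilon)$ denotes the output $\mathbf D(\mathbf E(w,\xi))$ of such a scheme with $\alpha=\varepsilon$. For inputs of norm at most $M$, $Q(\cdot,\varepsilon)$ is realised by a scheme using at most $\lceil1.05d+d\log_2(2+M/\varepsilon)\rceil$ bits. The number of bits communicated at an iteration is the total over all messages sent (nodes to server $0$ and server $0$ to nodes). The constant in $O(Nd)$ does not depend on $k$, $N$, $d$ (it may depend on problem and algorithm parameters). **A-DEED-GD.** Let $\tau=\frac{\sqrt L-\sqrt\mu}{\sqrt L+\sqrt\mu}$. Initialize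 $x_0=y_0=0$ and $s_{-1}^i=s_{-1}=v_{-1}=0$. For $k=0,1,2,\dots$: each node $i$ computes $g_k^i=\nabla f_i(y_k)$, $d_k^i=Q(g_k^i-s_{k-1}^i,\ s(c')^{k+1}/2)$, sets $s_k^i=d_k^i+s_{k-1}^i$, and sends $d_k^i$ to server $0$. Server $0$ computes $s_k=\frac1N\sum_{i=1}^Nd_k^i+s_{k-1}$ and $u_k=Q(s_k-v_{k-1},\ s(c')^{k+1}/2)$, and sends $u_k$ to all nodes. All servers set $v_k=u_k+v_{k-1}$; nodes set $x_{k+1}=y_k-\eta v_k$ and $y_{k+1}=x_{k+1}+\tau(x_{k+1}-x_k)$. *)

theory Defs
  imports "HOL-Probability.Probability"
begin

(* The dimension d has to be quantified inside a formula (the constant in O(N d) must not depend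
   on d), so it cannot be a type.  All spaces R^d are realised inside one inner product space, the
   space of finitely supported real sequences; R^d is the subspace of sequences supported on
   {0..<d}, with the usual Euclidean inner product and norm. *)

typedef rvec = "{x :: nat \<Rightarrow> real. finite {i. x i \<noteq> 0}}"
  morphisms coord Abs_rvec
  by (rule exI[of _ "\<lambda>_. 0"]) simp

lemma finite_coord: "finite {i. coord x i \<noteq> 0}"
  using coord[of x] by simp

lemma rvec_eqI: "(\<And>i. coord x i = coord y i) \<Longrightarrow> x = y"
  by (simp add: coord_inject[symmetric] fun_eq_iff)

instantiation rvec :: real_vector
begin

definition zero_rvec :: rvec where "0 = Abs_rvec (\<lambda>_. 0)"
definition plus_rvec :: "rvec \<Rightarrow> rvec \<Rightarrow> rvec" where
  "x + y = Abs_rvec (\<lambda>i. coord x i + coord y i)"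
definition uminus_rvec :: "rvec \<Rightarrow> rvec" where "- x = Abs_rvec (\<lambda>i. - coord x i)"
definition minus_rvec :: "rvec \<Rightarrow> rvec \<Rightarrow> rvec" where
  "x - y = Abs_rvec (\<lambda>i. coord x i - coord y i)"
definition scaleR_rvec :: "real \<Rightarrow> rvec \<Rightarrow> rvec" where
  "a *\<^sub>R x = Abs_rvec (\<lambda>i. a * coord x i)"

lemma coord_zero: "coord 0 i = 0"
  by (simp add: zero_rvec_def Abs_rvec_inverse)

lemma coord_plus: "coord (x + y) i = coord x i + coord y i"
proof -
  have "finite {i. coord x i + coord y i \<noteq> 0}"
    by (rule finite_subset[OF _ finite_UnI[OF finite_coord[of x] finite_coord[of y]]]) auto
  then show ?thesis by (simp add: plus_rvec_def Abs_rvec_inverse)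
qed

lemma coord_minus: "coord (x - y) i = coord x i - coord y i"
proof -
  have "finite {i. coord x i - coord y i \<noteq> 0}"
    by (rule finite_subset[OF _ finite_UnI[OF finite_coord[of x] finite_coord[of y]]]) auto
  then show ?thesis by (simp add: minus_rvec_def Abs_rvec_inverse)
qed

lemma coord_uminus: "coord (- x) i = - coord x i"
  by (simp add: uminus_rvec_def Abs_rvec_inverse finite_coord)

lemma coord_scaleR: "coord (a *\<^sub>R x) i = a * coord x i"
proof -
  have "finite {i. a * coord x i \<noteq> 0}"
    by (rule finite_subset[OF _ finite_coord[of x]]) auto
  then show ?thesis by (simp add: scaleR_rvec_def Abs_rvec_inverse)
qed

lemmas coord_simps = coord_zero coord_plus coord_minus coord_uminus coord_scaleR

instance
proof
  fix x y z :: rvec and a b :: real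
  show "x + y + z = x + (y + z)" by (rule rvec_eqI) (simp add: coord_simps)
  show "x + y = y + x" by (rule rvec_eqI) (simp add: coord_simps)
  show "0 + x = x" by (rule rvec_eqI) (simp add: coord_simps)
  show "- x + x = 0" by (rule rvec_eqI) (simp add: coord_simps)
  show "x - y = x + - y" by (rule rvec_eqI) (simp add: coord_simps)
  show "a *\<^sub>R (x + y) = a *\<^sub>R x + a *\<^sub>R y"
    by (rule rvec_eqI) (simp add: coord_simps algebra_simps)
  show "(a + b) *\<^sub>R x = a *\<^sub>R x + b *\<^sub>R x"
    by (rule rvec_eqI) (simp add: coord_simps algebra_simps)
  show "a *\<^sub>R b *\<^sub>R x = (a * b) *\<^sub>R x" by (rule rvec_eqI) (simp add: coord_simps)
  show "1 *\<^sub>R x = x" by (rule rvec_eqI) (simp add: coord_simps)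
qed

end

instantiation rvec :: real_inner
begin

definition inner_rvec :: "rvec \<Rightarrow> rvec \<Rightarrow> real" where
  "x \<bullet> y = (\<Sum>i | coord x i \<noteq> 0. coord x i * coord y i)"
definition norm_rvec :: "rvec \<Rightarrow> real" where "norm (x :: rvec) = sqrt (x \<bullet> x)"
definition sgn_rvec :: "rvec \<Rightarrow> rvec" where "sgn (x :: rvec) = x /\<^sub>R norm x"
definition dist_rvec :: "rvec \<Rightarrow> rvec \<Rightarrow> real" where "dist (x :: rvec) y = norm (x - y)"
definition uniformity_rvec :: "(rvec \<times> rvec) filter" where
  "uniformity = (INF e\<in>{0<..}. principal {(x :: rvec, y). dist x y < e})"
definition open_rvec :: "rvec set \<Rightarrow> bool" where
  "open (U :: rvec set) \<longleftrightarrow> (\<forall>x\<in>U. eventually (\<lambda>(x', y). x' = x \<longrightarrow> y \<in> U) uniformity)"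

lemma inner_rvec_superset:
  assumes "finite A" "{i. coord x i \<noteq> 0} \<subseteq> A"
  shows "x \<bullet> y = (\<Sum>i\<in>A. coord x i * coord y i)"
  unfolding inner_rvec_def by (rule sum.mono_neutral_left) (use assms in auto)

instance
proof
  fix x y z :: rvec and a :: real and U :: "rvec set"
  show "dist x y = norm (x - y)" by (rule dist_rvec_def)
  show "sgn x = x /\<^sub>R norm x" by (rule sgn_rvec_def)
  show "uniformity = (INF e\<in>{0<..}. principal {(x :: rvec, y). dist x y < e})"
    by (rule uniformity_rvec_def)
  show "open U \<longleftrightarrow> (\<forall>x\<in>U. \<forall>\<^sub>F (x', y) in uniformity. x' = x \<longrightarrow> y \<in> U)"
    by (rule open_rvec_def)
  show "norm x = sqrt (x \<bullet> x)" by (rule norm_rvec_def)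
  let ?A = "{i. coord x i \<noteq> 0} \<union> {i. coord y i \<noteq> 0}"
  have fin: "finite ?A" by (simp add: finite_coord)
  have supp: "{i. coord x i \<noteq> 0} \<subseteq> ?A" "{i. coord y i \<noteq> 0} \<subseteq> ?A"
    "{i. coord (x + y) i \<noteq> 0} \<subseteq> ?A" "{i. coord (a *\<^sub>R x) i \<noteq> 0} \<subseteq> ?A"
    by (auto simp: coord_simps)
  note ex = inner_rvec_superset[OF fin supp(1)] inner_rvec_superset[OF fin supp(2)]
    inner_rvec_superset[OF fin supp(3)] inner_rvec_superset[OF fin supp(4)]
  show "x \<bullet> y = y \<bullet> x" unfolding ex by (simp add: mult.commute)
  show "(x + y) \<bullet> z = x \<bullet> z + y \<bullet> z"
    unfolding ex by (simp add: coord_simps algebra_simps sum.distrib)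
  show "a *\<^sub>R x \<bullet> y = a * (x \<bullet> y)"
    unfolding ex by (simp add: coord_simps algebra_simps sum_distrib_left)
  show "0 \<le> x \<bullet> x" unfolding inner_rvec_def by (intro sum_nonneg) simp
  have "x \<bullet> x = 0 \<longleftrightarrow> (\<forall>i\<in>{i. coord x i \<noteq> 0}. coord x i * coord x i = 0)"
    unfolding inner_rvec_def by (rule sum_nonneg_eq_0_iff) (auto simp: finite_coord)
  also have "\<dots> \<longleftrightarrow> (\<forall>i. coord x i = 0)" by auto
  also have "\<dots> \<longleftrightarrow> x = 0"
  proof
    assume "\<forall>i. coord x i = 0"
    then show "x = 0" by (intro rvec_eqI) (simp add: coord_simps)
  qed (simp add: coord_simps)
  finally show "x \<bullet> x = 0 \<longleftrightarrow> x = 0" .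
qed

end

definition Rd :: "nat \<Rightarrow> rvec set" where
  "Rd d = {x. \<forall>i\<ge>d. coord x i = 0}"

definition grad :: "nat \<Rightarrow> (rvec \<Rightarrow> real) \<Rightarrow> rvec \<Rightarrow> rvec" where
  "grad d h x = (THE g. g \<in> Rd d \<and> (h has_derivative (\<lambda>z. g \<bullet> z)) (at x within Rd d))"

definition smooth :: "nat \<Rightarrow> real \<Rightarrow> (rvec \<Rightarrow> real) \<Rightarrow> bool" where
  "smooth d L h \<longleftrightarrow> h differentiable_on Rd d \<and>
     (\<forall>x\<in>Rd d. \<forall>y\<in>Rd d.
        \<bar>h y - h x - (y - x) \<bullet> grad d h x\<bar> \<le> L / 2 * (norm (x - y))\<^sup>2)"

definition strongly_convex :: "nat \<Rightarrow> real \<Rightarrow> (rvec \<Rightarrow> real) \<Rightarrow> bool" where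
  "strongly_convex d \<mu> h \<longleftrightarrow> h differentiable_on Rd d \<and>
     (\<forall>x\<in>Rd d. \<forall>y\<in>Rd d.
        h y - h x - (y - x) \<bullet> grad d h x \<ge> \<mu> / 2 * (norm (x - y))\<^sup>2)"

definition avg :: "nat \<Rightarrow> (nat \<Rightarrow> rvec \<Rightarrow> real) \<Rightarrow> rvec \<Rightarrow> real" where
  "avg N f x = (\<Sum>i=1..N. f i x) / real N"

definition problem ::
  "nat \<Rightarrow> nat \<Rightarrow> real \<Rightarrow> real \<Rightarrow> (nat \<Rightarrow> rvec \<Rightarrow> real) \<Rightarrow> rvec \<Rightarrow> bool" where
  "problem d N L \<mu> f xs \<longleftrightarrow> d \<ge> 1 \<and> N \<ge> 1 \<and>
     (\<forall>i\<in>{1..N}. smooth d L (f i)) \<and> strongly_convex d \<mu> (avg N f) \<and>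
     xs \<in> Rd d \<and> (\<forall>x\<in>Rd d. avg N f xs \<le> avg N f x)"

record 'w scheme =
  inputs :: "rvec set"
  seeds :: "'w measure"
  enc :: "rvec \<Rightarrow> 'w \<Rightarrow> nat"
  dec :: "nat \<Rightarrow> rvec"

(* An infinite code set costs infinitely many bits (card would be 0). *)
definition seed_bits :: "'w scheme \<Rightarrow> 'w \<Rightarrow> ennreal" where
  "seed_bits S \<xi> = (let T = (\<lambda>w. enc S w \<xi>) ` inputs S in
     if finite T then ennreal (real_of_int \<lceil>log 2 (real (card T))\<rceil>) else \<infinity>)"

definition bits :: "'w scheme \<Rightarrow> ennreal" where
  "bits S = (\<integral>\<^sup>+ \<xi>. seed_bits S \<xi> \<partial>seeds S)"

(* The two measurability conditions are those under which the expectations make sense; the vector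
   expectation is taken coordinatewise. *)
definition encoding_scheme :: "nat \<Rightarrow> real \<Rightarrow> 'w scheme \<Rightarrow> bool" where
  "encoding_scheme d \<alpha> S \<longleftrightarrow>
     inputs S \<subseteq> Rd d \<and> prob_space (seeds S) \<and> seed_bits S \<in> borel_measurable (seeds S) \<and>
     (\<forall>n>0. dec S n \<in> Rd d) \<and>
     (\<forall>w\<in>inputs S.
        enc S w \<in> measurable (seeds S) (count_space UNIV) \<and>
        (\<forall>\<xi>\<in>space (seeds S). enc S w \<xi> > 0) \<and>
        (\<forall>j<d. (\<integral>\<xi>. coord (dec S (enc S w \<xi>)) j \<partial>seeds S) = coord w j) \<and>
        (\<forall>\<xi>\<in>space (seeds S). norm (dec S (enc S w \<xi>) - w) \<le> \<alpha>))"

definition quantize :: "'w scheme \<Rightarrow> rvec \<Rightarrow> 'w \<Rightarrow> rvec" where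
  "quantize S w \<xi> = dec S (enc S w \<xi>)"

definition ball_quantizer :: "nat \<Rightarrow> real \<Rightarrow> real \<Rightarrow> 'w scheme \<Rightarrow> bool" where
  "ball_quantizer d M \<epsilon> S \<longleftrightarrow> encoding_scheme d \<epsilon> S \<and> inputs S = {w \<in> Rd d. norm w \<le> M} \<and>
     bits S \<le> ennreal (real_of_int \<lceil>1.05 * real d + real d * log 2 (2 + M / \<epsilon>)\<rceil>)"

(* State at the start of iteration k: x_k, y_k, and the previous values s^i_{k-1}, s_{k-1}, v_{k-1}. *)
record deed_state =
  st_x :: rvec
  st_y :: rvec
  st_node :: "nat \<Rightarrow> rvec"
  st_server :: rvec
  st_v :: rvec

(* q j k and \<xi> j k are the scheme and the seed used by server j (0 being the central node) at
   iteration k. *)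

definition node_input :: "nat \<Rightarrow> (nat \<Rightarrow> rvec \<Rightarrow> real) \<Rightarrow> deed_state \<Rightarrow> nat \<Rightarrow> rvec" where
  "node_input d f st i = grad d (f i) (st_y st) - st_node st i"

definition node_msg :: "nat \<Rightarrow> (nat \<Rightarrow> rvec \<Rightarrow> real) \<Rightarrow> (nat \<Rightarrow> nat \<Rightarrow> 'w scheme) \<Rightarrow>
    (nat \<Rightarrow> nat \<Rightarrow> 'w) \<Rightarrow> nat \<Rightarrow> deed_state \<Rightarrow> nat \<Rightarrow> rvec" where
  "node_msg d f q \<xi> k st i = quantize (q i k) (node_input d f st i) (\<xi> i k)"

definition server_sum :: "nat \<Rightarrow> nat \<Rightarrow> (nat \<Rightarrow> rvec \<Rightarrow> real) \<Rightarrow> (nat \<Rightarrow> nat \<Rightarrow> 'w scheme) \<Rightarrow>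
    (nat \<Rightarrow> nat \<Rightarrow> 'w) \<Rightarrow> nat \<Rightarrow> deed_state \<Rightarrow> rvec" where
  "server_sum d N f q \<xi> k st =
     (1 / real N) *\<^sub>R (\<Sum>i=1..N. node_msg d f q \<xi> k st i) + st_server st"

definition server_input :: "nat \<Rightarrow> nat \<Rightarrow> (nat \<Rightarrow> rvec \<Rightarrow> real) \<Rightarrow> (nat \<Rightarrow> nat \<Rightarrow> 'w scheme) \<Rightarrow>
    (nat \<Rightarrow> nat \<Rightarrow> 'w) \<Rightarrow> nat \<Rightarrow> deed_state \<Rightarrow> rvec" where
  "server_input d N f q \<xi> k st = server_sum d N f q \<xi> k st - st_v st"

definition server_msg :: "nat \<Rightarrow> nat \<Rightarrow> (nat \<Rightarrow> rvec \<Rightarrow> real) \<Rightarrow> (nat \<Rightarrow> nat \<Rightarrow> 'w scheme) \<Rightarrow>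
    (nat \<Rightarrow> nat \<Rightarrow> 'w) \<Rightarrow> nat \<Rightarrow> deed_state \<Rightarrow> rvec" where
  "server_msg d N f q \<xi> k st = quantize (q 0 k) (server_input d N f q \<xi> k st) (\<xi> 0 k)"

definition deed_step :: "nat \<Rightarrow> nat \<Rightarrow> (nat \<Rightarrow> rvec \<Rightarrow> real) \<Rightarrow> real \<Rightarrow> real \<Rightarrow>
    (nat \<Rightarrow> nat \<Rightarrow> 'w scheme) \<Rightarrow> (nat \<Rightarrow> nat \<Rightarrow> 'w) \<Rightarrow> nat \<Rightarrow> deed_state \<Rightarrow> deed_state" where
  "deed_step d N f \<eta> \<tau> q \<xi> k st =
     (let v = server_msg d N f q \<xi> k st + st_v st;
          x' = st_y st - \<eta> *\<^sub>R v
      in \<lparr> st_x = x', st_y = x' + \<tau> *\<^sub>R (x' - st_x st),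
           st_node = (\<lambda>i. node_msg d f q \<xi> k st i + st_node st i),
           st_server = server_sum d N f q \<xi> k st, st_v = v \<rparr>)"

primrec deed :: "nat \<Rightarrow> nat \<Rightarrow> (nat \<Rightarrow> rvec \<Rightarrow> real) \<Rightarrow> real \<Rightarrow> real \<Rightarrow>
    (nat \<Rightarrow> nat \<Rightarrow> 'w scheme) \<Rightarrow> (nat \<Rightarrow> nat \<Rightarrow> 'w) \<Rightarrow> nat \<Rightarrow> deed_state" where
  "deed d N f \<eta> \<tau> q \<xi> 0 =
     \<lparr> st_x = 0, st_y = 0, st_node = (\<lambda>_. 0), st_server = 0, st_v = 0 \<rparr>"
| "deed d N f \<eta> \<tau> q \<xi> (Suc k) = deed_step d N f \<eta> \<tau> q \<xi> k (deed d N f \<eta> \<tau> q \<xi> k)"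

definition deed_input :: "nat \<Rightarrow> nat \<Rightarrow> (nat \<Rightarrow> rvec \<Rightarrow> real) \<Rightarrow> real \<Rightarrow> real \<Rightarrow>
    (nat \<Rightarrow> nat \<Rightarrow> 'w scheme) \<Rightarrow> (nat \<Rightarrow> nat \<Rightarrow> 'w) \<Rightarrow> nat \<Rightarrow> nat \<Rightarrow> rvec" where
  "deed_input d N f \<eta> \<tau> q \<xi> j k =
     (let st = deed d N f \<eta> \<tau> q \<xi> k in
      if j = 0 then server_input d N f q \<xi> k st else node_input d f st j)"

definition valid_seeds ::
  "nat \<Rightarrow> (nat \<Rightarrow> nat \<Rightarrow> 'w scheme) \<Rightarrow> (nat \<Rightarrow> nat \<Rightarrow> 'w) \<Rightarrow> bool" where
  "valid_seeds N q \<xi> \<longleftrightarrow> (\<forall>j\<le>N. \<forall>k. \<xi> j k \<in> space (seeds (q j k)))"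

(* The central node sends its message to each of the N computing nodes. *)
definition iteration_bits :: "nat \<Rightarrow> (nat \<Rightarrow> nat \<Rightarrow> 'w scheme) \<Rightarrow> nat \<Rightarrow> ennreal" where
  "iteration_bits N q k = (\<Sum>i=1..N. bits (q i k)) + (\<Sum>i=1..N. bits (q 0 k))"

end

theory Submission
  imports Defs
begin

text \<open>
  Part (1) is an inexact version of Nesterov's Lyapunov argument. With \<open>r = sqrt (\<mu> / L)\<close> and
  \<open>z\<^sub>k = x\<^sub>k + (1 / r - 1) (x\<^sub>k - x\<^sub>k\<^sub>-\<^sub>1)\<close>, the potential
  \<open>V\<^sub>k = f x\<^sub>k - f x\<^sup>* + \<mu> / 2 * \<parallel>z\<^sub>k - x\<^sup>*\<parallel>\<^sup>2\<close> satisfies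
  \<open>sqrt V\<^sub>k\<^sub>+\<^sub>1 \<le> c * sqrt V\<^sub>k + \<epsilon>\<^sub>k / sqrt L\<close> when the gradient used at step \<open>k\<close> has error at most
  \<open>\<epsilon>\<^sub>k = s c'\<^sup>k\<^sup>+\<^sup>1\<close>; hence \<open>sqrt V\<^sub>k \<le> c\<^sup>k sqrt \<Delta> + b c'\<^sup>k\<close> with
  \<open>b = s c' / (sqrt L (c' - c))\<close>, and \<open>2 b \<le> \<beta>\<^sub>s\<close>.

  For part (2), the rate of part (1) and the Lipschitz continuity of the gradients show that what is
  quantized at an iteration \<open>k \<ge> 1\<close> has norm at most a constant times \<open>c'\<^sup>k\<close>, so the ratio of
  radius to precision is constant. Since the rate itself needs the earlier inputs to lie in their
  balls, this is an induction on the iteration.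
\<close>

section \<open>Gradients on the subspaces\<close>

lemma subspace_Rd: "subspace (Rd d)"
  by (auto simp: subspace_def Rd_def coord_simps)

definition unit_rvec :: "nat \<Rightarrow> rvec" where
  "unit_rvec i = Abs_rvec (\<lambda>j. if j = i then 1 else 0)"

lemma coord_unit_rvec: "coord (unit_rvec i) j = (if j = i then 1 else 0)"
  by (simp add: unit_rvec_def Abs_rvec_inverse)

lemma coord_sum: "coord (sum F A) j = (\<Sum>i\<in>A. coord (F i) j)"
  by (induction A rule: infinite_finite_induct) (simp_all add: coord_simps)

lemma Rd_expansion:
  assumes "x \<in> Rd d"
  shows "x = (\<Sum>i<d. coord x i *\<^sub>R unit_rvec i)"
proof (rule rvec_eqI)
  fix j
  show "coord x j = coord (\<Sum>i<d. coord x i *\<^sub>R unit_rvec i) j"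
    using assms
    by (auto simp: coord_sum coord_simps coord_unit_rvec Rd_def if_distrib cong: if_cong)
qed

lemma inner_unit_rvec: "x \<bullet> unit_rvec i = coord x i"
proof -
  have "x \<bullet> unit_rvec i = unit_rvec i \<bullet> x" by (rule inner_commute)
  also have "\<dots> = (\<Sum>j\<in>{i}. coord (unit_rvec i) j * coord x j)"
    by (rule inner_rvec_superset) (auto simp: coord_unit_rvec)
  finally show ?thesis by (simp add: coord_unit_rvec)
qed

text \<open>Riesz representation in finite dimension: \<open>g\<close> collects the values of
  \<open>A\<close> on the first \<open>d\<close> unit vectors. Agreement is confined to
  \<open>Rd d\<close>, because on the whole sequence space a linear functional need not be an inner
  product.\<close>

lemma linear_on_Rd_represented:
  assumes "linear A"
  obtains g where "g \<in> Rd d" "\<And>z. z \<in> Rd d \<Longrightarrow> A z = g \<bullet> z"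
proof
  let ?g = "\<Sum>i<d. A (unit_rvec i) *\<^sub>R unit_rvec i"
  show g: "?g \<in> Rd d"
    by (auto simp: Rd_def coord_sum coord_simps coord_unit_rvec)
  fix z assume z: "z \<in> Rd d"
  have "A z = (\<Sum>i<d. coord z i * A (unit_rvec i))"
    by (subst Rd_expansion[OF z]) (simp add: linear_sum[OF assms] linear_scale[OF assms])
  also have "\<dots> = (\<Sum>i<d. coord z i * coord ?g i)"
    by (intro sum.cong) (auto simp: coord_sum coord_simps coord_unit_rvec if_distrib cong: if_cong)
  also have "\<dots> = ?g \<bullet> (\<Sum>i<d. coord z i *\<^sub>R unit_rvec i)"
    by (simp only: inner_sum_right inner_scaleR_right inner_unit_rvec)
  finally show "A z = ?g \<bullet> z" using Rd_expansion[OF z] by simp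
qed

text \<open>Restricting \<open>h\<close> to the line through \<open>x\<close> in direction
  \<open>g - g'\<close> reduces this to uniqueness of an ordinary derivative at 0; the two
  derivatives at 1 then differ by \<open>(norm (g - g'))\<^sup>2\<close>.\<close>

lemma derivative_on_Rd_unique:
  assumes "x \<in> Rd d" "g \<in> Rd d" "g' \<in> Rd d"
    and "(h has_derivative (\<lambda>z. g \<bullet> z)) (at x within Rd d)"
    and "(h has_derivative (\<lambda>z. g' \<bullet> z)) (at x within Rd d)"
  shows "g = g'"
proof -
  let ?w = "g - g'" let ?l = "\<lambda>t::real. x + t *\<^sub>R (g - g')"
  have w: "?w \<in> Rd d" using assms subspace_Rd by (simp add: subspace_diff)
  have im: "range ?l \<subseteq> Rd d"
    using assms(1) w subspace_Rd by (auto intro!: subspace_add subspace_scale)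
  have l: "(?l has_derivative (\<lambda>t. t *\<^sub>R ?w)) (at 0)"
    by (auto intro!: derivative_eq_intros)
  have D: "((\<lambda>t. h (?l t)) has_derivative (\<lambda>t. p \<bullet> (t *\<^sub>R ?w))) (at 0)"
    if "(h has_derivative (\<lambda>z. p \<bullet> z)) (at x within Rd d)" for p
  proof -
    have "(h has_derivative (\<lambda>z. p \<bullet> z)) (at (?l 0) within range ?l)"
      using has_derivative_subset[OF that im] by simp
    from has_derivative_in_compose[OF l this] show ?thesis .
  qed
  have "(\<lambda>t. g \<bullet> (t *\<^sub>R ?w)) = (\<lambda>t. g' \<bullet> (t *\<^sub>R ?w))"
    by (rule has_derivative_unique[OF D[OF assms(4)] D[OF assms(5)]])
  from fun_cong[OF this, of 1] have "?w \<bullet> ?w = 0" by (simp add: inner_diff_left)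
  then show ?thesis by simp
qed

lemma grad_eqI:
  assumes "x \<in> Rd d" "g \<in> Rd d" "(h has_derivative (\<lambda>z. g \<bullet> z)) (at x within Rd d)"
  shows "grad d h x = g"
  unfolding grad_def using assms derivative_on_Rd_unique by (intro the_equality) blast+

lemma
  assumes "h differentiable_on Rd d" "x \<in> Rd d"
  shows grad_in_Rd: "grad d h x \<in> Rd d"
    and has_derivative_grad: "(h has_derivative (\<lambda>z. grad d h x \<bullet> z)) (at x within Rd d)"
proof -
  obtain A where A: "(h has_derivative A) (at x within Rd d)"
    using assms by (auto simp: differentiable_on_def differentiable_def)
  then have "linear A" by (rule has_derivative_linear)
  then obtain g where g: "g \<in> Rd d" "\<And>z. z \<in> Rd d \<Longrightarrow> A z = g \<bullet> z"
    using linear_on_Rd_represented by blast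
  have "(h has_derivative (\<lambda>z. g \<bullet> z)) (at x within Rd d)"
    unfolding has_derivative_within
  proof
    show "bounded_linear (\<lambda>z. g \<bullet> z)" by (rule bounded_linear_inner_right)
    have "((\<lambda>y. (1 / norm (y - x)) *\<^sub>R (h y - (h x + A (y - x)))) \<longlongrightarrow> 0) (at x within Rd d)"
      using A by (simp add: has_derivative_within)
    \<comment> \<open>Near \<open>x\<close> within \<open>Rd d\<close> the quotient evaluates
      \<open>A\<close> only at \<open>y - x\<close>, which lies in \<open>Rd d\<close>, where
      \<open>A\<close> and \<open>g\<close> agree.\<close>
    then show "((\<lambda>y. (1 / norm (y - x)) *\<^sub>R (h y - (h x + g \<bullet> (y - x)))) \<longlongrightarrow> 0) (at x within Rd d)"
    proof (rule Lim_transform_eventually)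
      show "\<forall>\<^sub>F y in at x within Rd d. (1 / norm (y - x)) *\<^sub>R (h y - (h x + A (y - x)))
          = (1 / norm (y - x)) *\<^sub>R (h y - (h x + g \<bullet> (y - x)))"
        using assms(2) subspace_Rd
        by (auto simp: eventually_at_filter g(2) subspace_diff intro!: always_eventually)
    qed
  qed
  moreover from grad_eqI[OF assms(2) g(1) this] have "grad d h x = g" .
  ultimately show "grad d h x \<in> Rd d" "(h has_derivative (\<lambda>z. grad d h x \<bullet> z)) (at x within Rd d)"
    using g(1) by auto
qed

section \<open>Averages of smooth functions and Lipschitz gradients\<close>

lemma grad_avg:
  assumes "\<And>i. i \<in> {1..N} \<Longrightarrow> f i differentiable_on Rd d" "x \<in> Rd d"
  shows "grad d (avg N f) x = (1 / real N) *\<^sub>R (\<Sum>i=1..N. grad d (f i) x)"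
proof (rule grad_eqI[OF assms(2)])
  show "(1 / real N) *\<^sub>R (\<Sum>i=1..N. grad d (f i) x) \<in> Rd d"
    using assms by (intro subspace_scale subspace_sum subspace_Rd grad_in_Rd)
  have "((\<lambda>x. (1 / real N) *\<^sub>R (\<Sum>i=1..N. f i x)) has_derivative
      (\<lambda>z. (1 / real N) *\<^sub>R (\<Sum>i=1..N. grad d (f i) x \<bullet> z))) (at x within Rd d)"
    using assms by (intro has_derivative_scaleR_right has_derivative_sum has_derivative_grad)
  then show "(avg N f has_derivative
      (\<lambda>z. ((1 / real N) *\<^sub>R (\<Sum>i=1..N. grad d (f i) x)) \<bullet> z)) (at x within Rd d)"
    by (simp add: avg_def[abs_def] inner_sum_left)
qed

lemma norm_mean_le:
  fixes u :: "nat \<Rightarrow> 'a::real_normed_vector"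
  assumes "N \<ge> 1" "\<And>i. i \<in> {1..N} \<Longrightarrow> norm (u i) \<le> B"
  shows "norm ((1 / real N) *\<^sub>R (\<Sum>i=1..N. u i)) \<le> B"
proof -
  have "norm (\<Sum>i=1..N. u i) \<le> real (card {1..N}) * B"
    by (rule sum_norm_bound) (use assms in auto)
  then show ?thesis using assms(1) by (simp add: field_simps)
qed

lemma smooth_avg:
  assumes "N \<ge> 1" "\<And>i. i \<in> {1..N} \<Longrightarrow> smooth d L (f i)"
  shows "smooth d L (avg N f)"
  unfolding smooth_def
proof (intro conjI ballI)
  have diff: "f i differentiable_on Rd d" if "i \<in> {1..N}" for i
    using assms(2)[OF that] by (simp add: smooth_def)
  show "avg N f differentiable_on Rd d"
    unfolding avg_def[abs_def] divide_inverse using diff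
    by (auto simp: differentiable_on_def intro!: differentiable_mult differentiable_sum differentiable_const)
  fix x y assume x: "x \<in> Rd d" and y: "y \<in> Rd d"
  let ?t = "\<lambda>i. f i y - f i x - (y - x) \<bullet> grad d (f i) x"
  have "norm ((1 / real N) *\<^sub>R (\<Sum>i=1..N. ?t i)) \<le> L / 2 * (norm (x - y))\<^sup>2"
    by (rule norm_mean_le) (use assms x y in \<open>auto simp: smooth_def\<close>)
  moreover have "(1 / real N) *\<^sub>R (\<Sum>i=1..N. ?t i)
      = avg N f y - avg N f x - (y - x) \<bullet> grad d (avg N f) x"
    using grad_avg[of N f d x] diff x
    by (simp add: avg_def inner_sum_right sum_subtractf diff_divide_distrib)
  ultimately show "\<bar>avg N f y - avg N f x - (y - x) \<bullet> grad d (avg N f) x\<bar> \<le> L / 2 * (norm (x - y))\<^sup>2"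
    by (simp only: real_norm_def)
qed

text \<open>Evaluating the two-sided quadratic bound at a third point \<open>z\<close> with
  \<open>z - y\<close> parallel to the difference of the gradients avoids convexity, at the price of the factor 3.\<close>
lemma grad_Lipschitz:
  assumes h: "smooth d L h" and x: "x \<in> Rd d" and y: "y \<in> Rd d"
  shows "norm (grad d h y - grad d h x) \<le> 3 * L * norm (y - x)"
proof -
  have q: "\<bar>h b - h a - (b - a) \<bullet> grad d h a\<bar> \<le> L / 2 * (norm (a - b))\<^sup>2"
    if "a \<in> Rd d" "b \<in> Rd d" for a b
    using h that by (simp add: smooth_def)
  show ?thesis
  proof (cases "y = x")
    case True
    then show ?thesis by simp
  next
    case False
    have "0 \<le> L / 2 * (norm (x - y))\<^sup>2" using q[OF x y] by linarith
    then have L: "0 \<le> L" using False by (auto simp: zero_le_mult_iff)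
    define p where "p = grad d h y - grad d h x"
    \<comment> \<open>This length puts \<open>z\<close> as far from \<open>y\<close> as
      \<open>x\<close> is. The squared distances below are then at most 4, 1 and 1 times
      \<open>(norm (y - x))\<^sup>2\<close>, and half their sum is the factor 3. The values of
      \<open>h\<close> cancel in the combination of the three bounds.\<close>
    define t where "t = norm (y - x) / norm p"
    define z where "z = y + t *\<^sub>R p"
    show ?thesis
    proof (cases "p = 0")
      case True
      then show ?thesis using L by (simp add: p_def)
    next
      case p0: False
      have "p \<in> Rd d"
        unfolding p_def using h x y
        by (intro subspace_diff subspace_Rd grad_in_Rd) (auto simp: smooth_def)
      then have z: "z \<in> Rd d" unfolding z_def by (intro subspace_add subspace_scale subspace_Rd y)
      have zy: "z - y = t *\<^sub>R p" and nzy: "norm (y - z) = norm (y - x)"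
        using p0 by (auto simp: z_def t_def)
      have nxz: "norm (x - z) \<le> 2 * norm (y - x)"
        using norm_triangle_ineq[of "x - y" "y - z"] nzy by (simp add: norm_minus_commute)
      have "(z - y) \<bullet> p \<le> L / 2 * ((norm (x - z))\<^sup>2 + (norm (x - y))\<^sup>2 + (norm (y - z))\<^sup>2)"
      proof -
        have "(z - y) \<bullet> p = (z - y) \<bullet> grad d h y + (y - x) \<bullet> grad d h x - (z - x) \<bullet> grad d h x"
          by (simp add: p_def inner_diff_left inner_diff_right)
        with q[OF x z] q[OF y z] q[OF x y] show ?thesis unfolding abs_le_iff distrib_left by linarith
      qed
      also have "\<dots> \<le> L / 2 * ((2 * norm (y - x))\<^sup>2 + (norm (y - x))\<^sup>2 + (norm (y - x))\<^sup>2)"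
        using L nxz by (intro mult_left_mono add_mono power_mono) (auto simp: nzy norm_minus_commute)
      also have "\<dots> = norm (y - x) * (3 * L * norm (y - x))" by (simp add: power2_eq_square)
      finally have "norm (y - x) * norm p \<le> norm (y - x) * (3 * L * norm (y - x))"
        using p0 by (simp add: zy t_def power2_norm_eq_inner[symmetric] power2_eq_square)
      then show ?thesis using False by (simp add: p_def)
    qed
  qed
qed

section \<open>Accelerated gradient descent with inexact gradients\<close>

text \<open>Weighting \<open>sc1\<close> by \<open>r\<close> and \<open>sc2\<close> by
  \<open>1 - r\<close> gives the contraction factor \<open>1 - r\<close> for the exact gradient. The
  error \<open>v - g\<close> adds a cross term and a quadratic term that fit under a perfect square;
  hence the square roots, in which the error enters additively. \<open>lo\<close> serves to control
  \<open>norm w\<close> in the cross term.\<close>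

lemma nesterov_step:
  fixes x y z g v xs :: "'a::real_inner"
  assumes "0 < \<mu>" "\<mu> < L" and r: "r = sqrt (\<mu> / L)"
    and y: "(1 + r) *\<^sub>R y = x + r *\<^sub>R z"
    and x': "x' = y - (1 / L) *\<^sub>R v"
    and z': "z' = (1 - r) *\<^sub>R z + r *\<^sub>R y - (r / \<mu>) *\<^sub>R v"
    and sc1: "fs - fy - (xs - y) \<bullet> g \<ge> \<mu> / 2 * (norm (y - xs))\<^sup>2"
    and sc2: "fx - fy - (x - y) \<bullet> g \<ge> 0"
    and sm: "fx' - fy - (x' - y) \<bullet> g \<le> L / 2 * (norm (y - x'))\<^sup>2"
    and lo: "fs \<le> fy - (norm g)\<^sup>2 / (2 * L)" and fx: "fs \<le> fx"
    and err: "norm (v - g) \<le> \<epsilon>"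
  shows "sqrt (fx' - fs + \<mu> / 2 * (norm (z' - xs))\<^sup>2)
    \<le> sqrt (1 - r) * sqrt (fx - fs + \<mu> / 2 * (norm (z - xs))\<^sup>2) + \<epsilon> / sqrt L"
proof -
  define V where "V = fx - fs + \<mu> / 2 * (norm (z - xs))\<^sup>2"
  define a where "a = z - xs"
  define b where "b = y - xs"
  define e where "e = v - g"
  define u where "u = (1 - r) *\<^sub>R a + r *\<^sub>R b"
  define w where "w = u - (r / \<mu>) *\<^sub>R g"
  define A where "A = sqrt (1 - r) * sqrt V"
  have r01: "0 < r" "r < 1" and r2: "r\<^sup>2 = \<mu> / L" using assms(1,2) by (auto simp: r)
  have xy: "x - y = r *\<^sub>R (b - a)"
    using y by (simp add: a_def b_def algebra_simps)
  have w: "z' - xs = w - (r / \<mu>) *\<^sub>R e"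
    by (simp add: z' w_def u_def a_def b_def e_def algebra_simps)
  have "(1 - r) * (norm a)\<^sup>2 + r * (norm b)\<^sup>2 - (norm u)\<^sup>2 = r * (1 - r) * (norm (a - b))\<^sup>2"
    unfolding u_def power2_norm_eq_inner
    by (simp add: inner_simps algebra_simps inner_commute)
  moreover have "0 \<le> r * (1 - r) * (norm (a - b))\<^sup>2" using r01 by simp
  ultimately have u: "(norm u)\<^sup>2 \<le> (1 - r) * (norm a)\<^sup>2 + r * (norm b)\<^sup>2" by linarith
  \<comment> \<open>Applied twice: to \<open>u\<close> and \<open>g\<close> for the exact step, then
    to \<open>w\<close> and \<open>e\<close> for the error.\<close>
  have expand: "\<mu> / 2 * (norm (p - (r / \<mu>) *\<^sub>R q))\<^sup>2
      = \<mu> / 2 * (norm p)\<^sup>2 - r * (p \<bullet> q) + (norm q)\<^sup>2 / (2 * L)" for p q :: 'a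
  proof -
    have "\<mu> / 2 * (norm (p - (r / \<mu>) *\<^sub>R q))\<^sup>2
        = \<mu> / 2 * (norm p)\<^sup>2 - r * (p \<bullet> q) + r\<^sup>2 / (2 * \<mu>) * (norm q)\<^sup>2"
      using assms(1) unfolding power2_norm_eq_inner
      by (simp add: inner_simps inner_commute power2_eq_square field_simps)
    then show ?thesis using assms(1) by (simp add: r2)
  qed
  define P where "P = fy - (norm g)\<^sup>2 / (2 * L) - fs"
  \<comment> \<open>The inner products with \<open>g\<close> collect to
    \<open>r * (u \<bullet> g)\<close>, and the squared norm of \<open>g\<close> from
    \<open>expand\<close> cancels the one in \<open>P\<close>.\<close>
  have "r * (fs - fy + b \<bullet> g - \<mu> / 2 * (norm b)\<^sup>2) \<ge> 0"
    using sc1 r01 by (simp add: b_def inner_diff_left)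
  moreover have "(1 - r) * (fx - fy - r * ((b - a) \<bullet> g)) \<ge> 0"
    using sc2 r01 by (simp add: xy)
  moreover have "r * (u \<bullet> g) = r * (b \<bullet> g) - (1 - r) * (r * ((b - a) \<bullet> g))"
    by (simp add: u_def inner_simps algebra_simps)
  moreover have "\<mu> / 2 * (norm u)\<^sup>2 \<le> \<mu> / 2 * ((1 - r) * (norm a)\<^sup>2 + r * (norm b)\<^sup>2)"
    using u assms(1) by simp
  ultimately have exact: "P + \<mu> / 2 * (norm w)\<^sup>2 \<le> (1 - r) * V"
    unfolding w_def expand P_def V_def a_def[symmetric] by (simp add: field_simps)
  have P0: "0 \<le> P" using lo by (simp add: P_def)
  have V0: "0 \<le> V" using fx assms(1) by (simp add: V_def)
  have A0: "0 \<le> A" and A2: "A\<^sup>2 = (1 - r) * V" using r01 V0 by (auto simp: A_def power_mult_distrib)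
  have e0: "0 \<le> \<epsilon>" using err norm_ge_zero order_trans by blast
  have L0: "0 < L" using assms by simp
  \<comment> \<open>Since \<open>P\<close> is nonnegative, \<open>exact\<close> alone bounds
    \<open>norm w\<close>. The factor 2 is weakened to 4 so that the root is rational and the cross
    term is the one of \<open>(A + \<epsilon> / sqrt L)\<^sup>2\<close>.\<close>
  have "(r * norm w)\<^sup>2 \<le> (2 * (A / sqrt L))\<^sup>2"
  proof -
    have "\<mu> * (norm w)\<^sup>2 \<le> 2 * A\<^sup>2" using exact P0 by (simp add: A2)
    then have "\<mu> * (norm w)\<^sup>2 / L \<le> 2 * A\<^sup>2 / L" using L0 by (simp add: divide_right_mono)
    also have "\<dots> \<le> 4 * A\<^sup>2 / L" using L0 by (intro divide_right_mono) auto
    finally show ?thesis using L0 by (simp add: power_mult_distrib power_divide r2)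
  qed
  then have rw: "r * norm w \<le> 2 * (A / sqrt L)"
    by (rule power2_le_imp_le) (use A0 L0 in auto)
  have "- (r * (w \<bullet> e)) \<le> r * (norm w * norm e)"
    using Cauchy_Schwarz_ineq2[of w e] r01
    by (smt (verit) mult_left_mono mult_minus_right)
  also have "\<dots> = (r * norm w) * norm e" by simp
  also have "\<dots> \<le> 2 * (A / sqrt L) * \<epsilon>"
    using err A0 L0 by (intro mult_mono[OF rw]) (auto simp: e_def)
  finally have cross: "- (r * (w \<bullet> e)) \<le> 2 * A * (\<epsilon> / sqrt L)" by simp
  have e2: "(norm e)\<^sup>2 / L \<le> \<epsilon>\<^sup>2 / L"
    using err L0 by (intro divide_right_mono power_mono) (auto simp: e_def)
  have "fx' - fs \<le> P + (norm e)\<^sup>2 / (2 * L)"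
  proof -
    have "fx' - fy \<le> - (v \<bullet> g) / L + L / 2 * (norm v / L)\<^sup>2"
      using sm L0 by (simp add: x')
    also have "L / 2 * (norm v / L)\<^sup>2 = (norm v)\<^sup>2 / (2 * L)"
      using L0 by (simp add: power2_eq_square)
    also have "(norm v)\<^sup>2 = (norm e)\<^sup>2 + 2 * (v \<bullet> g) - (norm g)\<^sup>2"
      unfolding e_def power2_norm_eq_inner by (simp add: inner_simps inner_commute)
    also have "- (v \<bullet> g) / L + ((norm e)\<^sup>2 + 2 * (v \<bullet> g) - (norm g)\<^sup>2) / (2 * L)
        = (norm e)\<^sup>2 / (2 * L) - (norm g)\<^sup>2 / (2 * L)"
      using L0 by (simp add: field_simps)
    finally show ?thesis by (simp add: P_def)
  qed
  moreover have "\<mu> / 2 * (norm (z' - xs))\<^sup>2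
      = \<mu> / 2 * (norm w)\<^sup>2 - r * (w \<bullet> e) + (norm e)\<^sup>2 / (2 * L)"
    unfolding w by (rule expand)
  ultimately have "fx' - fs + \<mu> / 2 * (norm (z' - xs))\<^sup>2
      \<le> P + \<mu> / 2 * (norm w)\<^sup>2 - r * (w \<bullet> e) + (norm e)\<^sup>2 / L"
    by (simp add: field_simps)
  also have "\<dots> \<le> A\<^sup>2 + 2 * A * (\<epsilon> / sqrt L) + \<epsilon>\<^sup>2 / L"
    using exact cross e2 A2 by linarith
  also have "\<dots> = (A + \<epsilon> / sqrt L)\<^sup>2" using L0 by (simp add: power2_sum power_divide)
  finally have "sqrt (fx' - fs + \<mu> / 2 * (norm (z' - xs))\<^sup>2) \<le> A + \<epsilon> / sqrt L"
    using A0 e0 L0 by (intro real_le_lsqrt) auto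
  then show ?thesis by (simp add: A_def V_def)
qed

text \<open>
  The term \<open>s * c' / (sqrt L * (c' - c)) * c' ^ k\<close> bounds the accumulated errors
  \<open>\<Sum>j<k. c ^ (k - 1 - j) * s * c' ^ (j + 1) / sqrt L\<close>.
\<close>
lemma inexact_nesterov:
  fixes x y v :: "nat \<Rightarrow> 'a::real_inner" and F :: "'a \<Rightarrow> real" and G :: "'a \<Rightarrow> 'a"
  assumes \<mu>: "0 < \<mu>" "\<mu> < L"
    and \<tau>: "\<tau> = (sqrt L - sqrt \<mu>) / (sqrt L + sqrt \<mu>)"
    and c: "c = sqrt (1 - sqrt (\<mu> / L))" "c < c'" and s: "0 \<le> s"
    and S: "subspace S" "xs \<in> S" "\<And>a. a \<in> S \<Longrightarrow> G a \<in> S"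
    and sc: "\<And>a b. a \<in> S \<Longrightarrow> b \<in> S \<Longrightarrow> F b - F a - (b - a) \<bullet> G a \<ge> \<mu> / 2 * (norm (a - b))\<^sup>2"
    and sm: "\<And>a b. a \<in> S \<Longrightarrow> b \<in> S \<Longrightarrow> F b - F a - (b - a) \<bullet> G a \<le> L / 2 * (norm (a - b))\<^sup>2"
    and min: "\<And>a. a \<in> S \<Longrightarrow> F xs \<le> F a"
    and iter: "\<And>k. k \<le> n \<Longrightarrow> x k \<in> S" "\<And>k. k \<le> n \<Longrightarrow> y k \<in> S"
    and init: "y 0 = x 0"
    and rec_x: "\<And>k. k < n \<Longrightarrow> x (Suc k) = y k - (1 / L) *\<^sub>R v k"
    and rec_y: "\<And>k. k < n \<Longrightarrow> y (Suc k) = x (Suc k) + \<tau> *\<^sub>R (x (Suc k) - x k)"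
    and err: "\<And>k. k < n \<Longrightarrow> norm (v k - G (y k)) \<le> s * c' ^ (k + 1)"
    and "k \<le> n"
  shows "\<mu> / 2 * (norm (x k - xs))\<^sup>2
    \<le> (c ^ k * sqrt (F (x 0) - F xs + \<mu> / 2 * (norm (x 0 - xs))\<^sup>2)
        + s * c' / (sqrt L * (c' - c)) * c' ^ k)\<^sup>2"
proof -
  define r where "r = sqrt (\<mu> / L)"
  \<comment> \<open>The value at 0 amounts to the convention that the iterate before
    \<open>x 0\<close> is \<open>x 0\<close> itself, so \<open>V 0\<close> is the initial gap of the
    conclusion.\<close>
  define z where "z k = (case k of 0 \<Rightarrow> x 0 | Suc j \<Rightarrow> x (Suc j) + (1 / r - 1) *\<^sub>R (x (Suc j) - x j))" for k
  define V where "V k = F (x k) - F xs + \<mu> / 2 * (norm (z k - xs))\<^sup>2" for k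
  define b where "b = s * c' / (sqrt L * (c' - c))"
  have L0: "0 < L" using \<mu> by simp
  have r01: "0 < r" "r < 1" and r2: "r\<^sup>2 = \<mu> / L" using \<mu> by (auto simp: r_def)
  have c01: "0 < c" "c = sqrt (1 - r)" using c(1) r01 by (auto simp: r_def)
  have \<tau>r: "\<tau> = (1 - r) / (1 + r)"
  proof -
    have "1 - r = (sqrt L - sqrt \<mu>) / sqrt L" "1 + r = (sqrt L + sqrt \<mu>) / sqrt L"
      using L0 by (simp_all add: r_def real_sqrt_divide diff_divide_distrib add_divide_distrib)
    then show ?thesis using L0 by (simp add: \<tau>)
  qed
  have zy: "(1 + r) *\<^sub>R y k = x k + r *\<^sub>R z k" if "k \<le> n" for k
  proof (cases k)
    case 0
    then show ?thesis by (simp add: z_def init algebra_simps)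
  next
    case (Suc j)
    have "(1 + r) *\<^sub>R y k = (1 + r) *\<^sub>R x k + ((1 + r) * \<tau>) *\<^sub>R (x k - x j)"
      using rec_y[of j] that Suc by (simp add: scaleR_add_right)
    also have "(1 + r) * \<tau> = 1 - r" using r01 by (simp add: \<tau>r)
    also have "(1 + r) *\<^sub>R x k + (1 - r) *\<^sub>R (x k - x j) = x k + r *\<^sub>R z k"
      using r01 by (simp add: z_def Suc scaleR_add_right scaleR_add_left right_diff_distrib)
    finally show ?thesis .
  qed
  have z_rec: "z (Suc k) = (1 - r) *\<^sub>R z k + r *\<^sub>R y k - (r / \<mu>) *\<^sub>R v k" if "k < n" for k
  proof -
    have "r *\<^sub>R z (Suc k) = x (Suc k) - (1 - r) *\<^sub>R x k"
      using r01 by (simp add: z_def scaleR_add_right scaleR_diff_left scaleR_diff_right right_diff_distrib)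
    also have "x k = (1 + r) *\<^sub>R y k - r *\<^sub>R z k" using zy[of k] that by simp
    also have "x (Suc k) - (1 - r) *\<^sub>R \<dots>
        = (r * (1 - r)) *\<^sub>R z k + r\<^sup>2 *\<^sub>R y k - (1 / L) *\<^sub>R v k"
      using rec_x[OF that] by (simp add: algebra_simps power2_eq_square)
    also have "1 / L = r * (r / \<mu>)" using r2 \<mu> by (simp add: power2_eq_square)
    also have "(r * (1 - r)) *\<^sub>R z k + r\<^sup>2 *\<^sub>R y k - (r * (r / \<mu>)) *\<^sub>R v k
        = r *\<^sub>R ((1 - r) *\<^sub>R z k + r *\<^sub>R y k - (r / \<mu>) *\<^sub>R v k)"
      by (simp add: scaleR_add_right scaleR_diff_right power2_eq_square)
    finally show ?thesis using r01 by (simp only: scaleR_cancel_left) simp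
  qed
  \<comment> \<open>A gradient step from \<open>a\<close> stays in \<open>S\<close> and cannot go
    below the minimum. This supplies \<open>lo\<close> in every step; at \<open>a = xs\<close> it
    makes the gradient vanish.\<close>
  have descent: "F xs \<le> F a - (norm (G a))\<^sup>2 / (2 * L)" if a: "a \<in> S" for a
  proof -
    have a': "a - (1 / L) *\<^sub>R G a \<in> S"
      using S a by (simp add: subspace_diff subspace_scale)
    have "F (a - (1 / L) *\<^sub>R G a) - F a + (norm (G a))\<^sup>2 / L \<le> (norm (G a))\<^sup>2 / (2 * L)"
      using sm[OF a a'] L0 by (simp add: dot_square_norm power_divide power2_eq_square)
    moreover have "(norm (G a))\<^sup>2 / L = 2 * ((norm (G a))\<^sup>2 / (2 * L))" by simp
    ultimately show ?thesis using min[OF a'] by linarith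
  qed
  have step: "sqrt (V (Suc k)) \<le> c * sqrt (V k) + s * c' ^ (k + 1) / sqrt L" if k: "k < n" for k
    unfolding V_def c01(2)
  proof (rule nesterov_step[OF \<mu> r_def zy rec_x z_rec, where fy = "F (y k)" and g = "G (y k)"])
    show "F (x k) - F (y k) - (x k - y k) \<bullet> G (y k) \<ge> 0"
      using sc[of "y k" "x k"] iter k \<mu> by (smt (verit) less_imp_le zero_le_mult_iff zero_le_power2
          divide_nonneg_nonneg)
  qed (use k iter S sc sm descent err min in auto)
  \<comment> \<open>The difference \<open>c' ^ k - c ^ k\<close> is what solves the recursion of
    \<open>step\<close> exactly, starting from 0. Its negative part is dropped only after the
    induction.\<close>
  have V_bound: "k \<le> n \<Longrightarrow> sqrt (V k) \<le> c ^ k * sqrt (V 0) + b * (c' ^ k - c ^ k)" for k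
  proof (induction k)
    case (Suc k)
    have "sqrt (V (Suc k)) \<le> c * (c ^ k * sqrt (V 0) + b * (c' ^ k - c ^ k)) + s * c' ^ (k + 1) / sqrt L"
      using step[of k] Suc c01 by (smt (verit) Suc_leD Suc_le_lessD mult_left_mono)
    also have "s * c' ^ (k + 1) / sqrt L = b * (c' - c) * c' ^ k"
      using c L0 by (simp add: b_def)
    finally show ?case by (simp add: algebra_simps)
  qed simp
  have "norm (G xs) = 0" using descent[OF S(2)] L0 by (simp add: field_simps)
  then have "\<mu> / 2 * (norm (x k - xs))\<^sup>2 \<le> F (x k) - F xs"
    using sc[OF S(2) iter(1)] \<open>k \<le> n\<close> by (simp add: norm_minus_commute)
  also have "\<dots> \<le> V k" using \<mu> by (simp add: V_def)
  also have "V k \<le> (c ^ k * sqrt (V 0) + b * (c' ^ k - c ^ k))\<^sup>2"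
    by (rule sqrt_le_D) (rule V_bound[OF \<open>k \<le> n\<close>])
  also have "\<dots> \<le> (c ^ k * sqrt (V 0) + b * c' ^ k)\<^sup>2"
  proof (rule power_mono)
    have "0 \<le> V 0" using min[OF iter(1)] \<mu> by (simp add: V_def)
    moreover have "0 \<le> b" using c(2) c01(1) s L0 by (simp add: b_def)
    moreover have "c ^ k \<le> c' ^ k" using c01(1) c(2) by (intro power_mono) auto
    ultimately show "0 \<le> c ^ k * sqrt (V 0) + b * (c' ^ k - c ^ k)"
      using c01 by simp
    show "c ^ k * sqrt (V 0) + b * (c' ^ k - c ^ k) \<le> c ^ k * sqrt (V 0) + b * c' ^ k"
      using \<open>0 \<le> b\<close> c01 by (simp add: mult_left_mono)
  qed
  finally show ?thesis by (simp add: V_def z_def b_def)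
qed

section \<open>The constants\<close>

text \<open>\<open>\<Delta>\<close> is an arbitrary real here, not yet tied to an objective. All
  constants built in this locale are thus fixed before \<open>d\<close>, \<open>N\<close> and the
  functions, as the bit bound requires.\<close>

locale deed_params =
  fixes L \<mu> \<eta> \<tau> c c' s \<gamma> \<Delta> \<alpha>\<^sub>s \<beta>\<^sub>s C :: real
  assumes \<mu>: "0 < \<mu>" "\<mu> < L"
    and \<eta>: "\<eta> = 1 / L"
    and \<tau>: "\<tau> = (sqrt L - sqrt \<mu>) / (sqrt L + sqrt \<mu>)"
    and c: "c = sqrt (1 - sqrt (\<mu> / L))"
    and c': "c < c'" "c' < 1" and s: "0 < s"
    and \<gamma>: "\<gamma> = c' / c"
    and \<alpha>: "\<alpha>\<^sub>s = s\<^sup>2 / (L * (\<gamma>\<^sup>2 - 1)) + \<Delta>"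
    and \<beta>: "\<beta>\<^sub>s = (3 * sqrt (2 / L) + 5 * sqrt (2 / \<mu>)) / (c * (\<gamma>\<^sup>2 - 1)) * s * \<gamma>"
    and C: "C = \<beta>\<^sub>s\<^sup>2 + \<alpha>\<^sub>s + \<beta>\<^sub>s * sqrt \<alpha>\<^sub>s - \<Delta>"
begin

lemma L_pos: "0 < L" and c_pos: "0 < c" and c'_pos: "0 < c'" and \<gamma>_gt_1: "1 < \<gamma>"
proof -
  show "0 < L" using \<mu> by simp
  show "0 < c" using \<mu> by (simp add: c)
  then show "0 < c'" "1 < \<gamma>" using c' by (auto simp: \<gamma>)
qed

lemma \<alpha>_ge_\<Delta>: "\<Delta> \<le> \<alpha>\<^sub>s"
  using L_pos \<gamma>_gt_1 s by (simp add: \<alpha>)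

text \<open>Clearing \<open>c\<close> from \<gamma> makes both sides multiples of
  \<open>s * c' / (c'\<^sup>2 - c\<^sup>2)\<close>. On the left the factor is
  \<open>2 * (c' + c) / sqrt L\<close>, at most \<open>4 / sqrt L\<close>, and
  \<open>1 / sqrt L\<close> is below \<open>sqrt (2 / \<mu>)\<close>.\<close>

lemma \<beta>_ge: "2 * (s * c' / (sqrt L * (c' - c))) \<le> \<beta>\<^sub>s"
proof -
  let ?t = "s * c' / (c'\<^sup>2 - c\<^sup>2)"
  have p: "0 < c'\<^sup>2 - c\<^sup>2" using c' c_pos by (simp add: power_strict_mono)
  have t: "0 \<le> ?t" using p s c'_pos by simp
  have "\<gamma>\<^sup>2 - 1 = (c'\<^sup>2 - c\<^sup>2) / c\<^sup>2" using c_pos by (simp add: \<gamma> field_simps)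
  then have \<beta>': "\<beta>\<^sub>s = (3 * sqrt (2 / L) + 5 * sqrt (2 / \<mu>)) * ?t"
    using c_pos p by (simp add: \<beta> \<gamma> power2_eq_square)
  have "1 / sqrt L = sqrt (1 / L)" by (simp add: real_sqrt_divide)
  also have "\<dots> \<le> sqrt (2 / \<mu>)" using \<mu> by (simp add: field_simps)
  finally have "1 / sqrt L \<le> sqrt (2 / \<mu>)" .
  moreover have "0 \<le> sqrt (2 / L)" "0 \<le> sqrt (2 / \<mu>)" using \<mu> by auto
  ultimately have "4 / sqrt L \<le> 3 * sqrt (2 / L) + 5 * sqrt (2 / \<mu>)"
    by linarith
  have "c'\<^sup>2 - c\<^sup>2 = (c' - c) * (c' + c)" by (simp add: power2_eq_square algebra_simps)
  moreover have "0 < c' + c" using c'_pos c_pos by simp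
  ultimately have "(c' + c) * ?t = s * c' / (c' - c)" by simp
  then have "2 * (s * c' / (sqrt L * (c' - c))) = 2 / sqrt L * ((c' + c) * ?t)" by simp
  also have "\<dots> = 2 * (c' + c) / sqrt L * ?t" by simp
  also have "\<dots> \<le> 4 / sqrt L * ?t"
    using t c' L_pos by (intro mult_right_mono divide_right_mono) auto
  also have "\<dots> \<le> \<beta>\<^sub>s" unfolding \<beta>' by (intro mult_right_mono t) fact
  finally show ?thesis .
qed

lemma error_sum_nonneg: "0 \<le> s * c' / (sqrt L * (c' - c))"
  using s c' c'_pos L_pos by simp

text \<open>\<open>C\<close> has to absorb all but the term \<open>\<Delta>\<close> in the square of
  \<open>sqrt \<Delta>\<close> plus the error constant; \<open>\<beta>\<^sub>s\<close> has room for
  twice that constant, and \<open>\<alpha>\<^sub>s\<close> dominates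
  \<open>\<Delta>\<close>.\<close>

lemma C_ge:
  assumes "0 \<le> \<Delta>"
  shows "(s * c' / (sqrt L * (c' - c)))\<^sup>2 + 2 * (s * c' / (sqrt L * (c' - c))) * sqrt \<Delta> \<le> C"
proof -
  define b where "b = s * c' / (sqrt L * (c' - c))"
  have b: "0 \<le> b" "2 * b \<le> \<beta>\<^sub>s" unfolding b_def by (rule error_sum_nonneg \<beta>_ge)+
  then have "b\<^sup>2 \<le> \<beta>\<^sub>s\<^sup>2" by (intro power_mono) auto
  moreover have "2 * b * sqrt \<Delta> \<le> \<beta>\<^sub>s * sqrt \<alpha>\<^sub>s"
    using b \<alpha>_ge_\<Delta> assms by (intro mult_mono) auto
  ultimately show ?thesis using \<alpha>_ge_\<Delta> unfolding b_def by (simp add: C)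
qed

lemma C_nonneg: "0 \<le> \<Delta> \<Longrightarrow> 0 \<le> C"
  by (rule order_trans[OF _ C_ge]) (simp_all add: error_sum_nonneg del: times_divide_eq_right)

lemma \<tau>_bounds: "0 \<le> \<tau>" "\<tau> \<le> 1"
proof -
  have "sqrt \<mu> \<le> sqrt L" "0 \<le> sqrt \<mu>" "0 < sqrt L + sqrt \<mu>" using \<mu> by (auto intro: add_pos_pos)
  then show "0 \<le> \<tau>" "\<tau> \<le> 1" unfolding \<tau> by (auto intro!: divide_nonneg_nonneg simp: divide_le_eq)
qed

definition rate_const :: real where
  "rate_const = sqrt (2 / \<mu>) * sqrt (\<Delta> + C)"

text \<open>
  Consecutive \<open>y\<^sub>k\<close> differ by at most \<open>6 * rate_const / c'\<^sup>2 * c' ^ (k + 1)\<close> and gradients are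
  \<open>3 * L\<close>-Lipschitz; the term \<open>2 * s\<close> pays for the quantization errors.
\<close>
definition input_const :: real where
  "input_const = 18 * L * rate_const / c'\<^sup>2 + 2 * s"

lemma input_const_nonneg: "0 \<le> \<Delta> \<Longrightarrow> 0 \<le> input_const"
  using C_nonneg L_pos \<mu> s by (simp add: input_const_def rate_const_def)

text \<open>In the expanded square the cross term has its factor \<open>c ^ k\<close> raised to
  \<open>c' ^ k\<close>. Only the \<open>\<Delta>\<close> term keeps \<open>(c ^ k)\<^sup>2\<close>,
  which becomes the division by \<open>\<gamma> ^ (2 * k)\<close>.\<close>

lemma rate_constant_bound:
  assumes "0 \<le> \<Delta>" "0 \<le> \<nu>"
    and bound: "\<mu> / 2 * \<nu>\<^sup>2 \<le> (c ^ k * sqrt \<Delta> + s * c' / (sqrt L * (c' - c)) * c' ^ k)\<^sup>2"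
  shows "\<nu> \<le> sqrt (2 / \<mu>) * c' ^ k * sqrt (\<Delta> / \<gamma> ^ (2 * k) + C)"
proof -
  define b where "b = s * c' / (sqrt L * (c' - c))"
  have b0: "0 \<le> b" by (simp only: b_def error_sum_nonneg)
  have ck: "0 \<le> c ^ k" "c ^ k \<le> c' ^ k" using c_pos c' by (auto intro: power_mono)
  have C': "b\<^sup>2 + 2 * b * sqrt \<Delta> \<le> C"
    unfolding b_def by (rule C_ge[OF assms(1)])
  have "(c ^ k * sqrt \<Delta> + b * c' ^ k)\<^sup>2
      = (c ^ k)\<^sup>2 * \<Delta> + c' ^ k * (2 * b * sqrt \<Delta> * c ^ k) + b\<^sup>2 * (c' ^ k)\<^sup>2"
    using assms(1) by (simp add: power2_sum power_mult_distrib algebra_simps)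
  also have "\<dots> \<le> (c ^ k)\<^sup>2 * \<Delta> + c' ^ k * (2 * b * sqrt \<Delta> * c' ^ k) + b\<^sup>2 * (c' ^ k)\<^sup>2"
    using ck b0 assms(1) c'_pos by (intro add_mono mult_left_mono) auto
  also have "\<dots> = (c ^ k)\<^sup>2 * \<Delta> + (c' ^ k)\<^sup>2 * (b\<^sup>2 + 2 * b * sqrt \<Delta>)"
    by (simp add: power2_eq_square algebra_simps)
  also have "\<dots> \<le> (c ^ k)\<^sup>2 * \<Delta> + (c' ^ k)\<^sup>2 * C" using C' by (simp add: mult_left_mono)
  also have "\<dots> = (c' ^ k)\<^sup>2 * (\<Delta> / \<gamma> ^ (2 * k) + C)"
    using c_pos c'_pos by (simp add: \<gamma> power_divide power_even_eq distrib_left)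
  finally have "\<mu> / 2 * \<nu>\<^sup>2 \<le> (c' ^ k)\<^sup>2 * (\<Delta> / \<gamma> ^ (2 * k) + C)"
    unfolding b_def by (rule order_trans[OF bound])
  then have "2 / \<mu> * (\<mu> / 2 * \<nu>\<^sup>2) \<le> 2 / \<mu> * ((c' ^ k)\<^sup>2 * (\<Delta> / \<gamma> ^ (2 * k) + C))"
    using \<mu> by (intro mult_left_mono) auto
  then have "\<nu>\<^sup>2 \<le> 2 / \<mu> * ((c' ^ k)\<^sup>2 * (\<Delta> / \<gamma> ^ (2 * k) + C))"
    using \<mu> by simp
  then have "sqrt (\<nu>\<^sup>2) \<le> sqrt (2 / \<mu> * ((c' ^ k)\<^sup>2 * (\<Delta> / \<gamma> ^ (2 * k) + C)))"
    by (rule real_sqrt_le_mono)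
  then show "\<nu> \<le> sqrt (2 / \<mu>) * c' ^ k * sqrt (\<Delta> / \<gamma> ^ (2 * k) + C)"
    unfolding real_sqrt_mult using assms(2) c'_pos by simp
qed

end

section \<open>Runs of the algorithm\<close>

lemma initial_gap_nonneg:
  assumes "0 < \<mu>" "problem d N L \<mu> f xs"
  shows "0 \<le> avg N f 0 - avg N f xs + \<mu> / 2 * (norm (0 - xs))\<^sup>2"
  using assms subspace_0[OF subspace_Rd] by (simp add: problem_def)

declare deed.simps(2) [simp del]

locale deed_run = deed_params L \<mu> \<eta> \<tau> c c' s \<gamma> \<Delta> \<alpha>\<^sub>s \<beta>\<^sub>s C
  for L \<mu> \<eta> \<tau> c c' s \<gamma> \<Delta> \<alpha>\<^sub>s \<beta>\<^sub>s C :: real +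
  fixes d N :: nat and f :: "nat \<Rightarrow> rvec \<Rightarrow> real" and xs :: rvec
    and q :: "nat \<Rightarrow> nat \<Rightarrow> 'w scheme" and \<xi> :: "nat \<Rightarrow> nat \<Rightarrow> 'w"
  assumes problem: "problem d N L \<mu> f xs"
    and \<Delta>: "\<Delta> = avg N f 0 - avg N f xs + \<mu> / 2 * (norm (0 - xs))\<^sup>2"
    and schemes: "\<And>j k. j \<le> N \<Longrightarrow> encoding_scheme d (s * c' ^ (k + 1) / 2) (q j k)"
    and seeds: "valid_seeds N q \<xi>"
begin

abbreviation "st k \<equiv> deed d N f \<eta> \<tau> q \<xi> k"
abbreviation "input j k \<equiv> deed_input d N f \<eta> \<tau> q \<xi> j k"
abbreviation "\<epsilon> k \<equiv> s * c' ^ (k + 1) / 2"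
abbreviation "G \<equiv> grad d (avg N f)"

text \<open>Error bounds are available only for inputs in the domain of their scheme. Restricting
  this to iterations before \<open>n\<close> lets the rate up to \<open>n\<close> be used to prove
  admissibility of iteration \<open>n\<close>.\<close>

definition admissible :: "nat \<Rightarrow> bool" where
  "admissible n \<longleftrightarrow> (\<forall>j\<le>N. \<forall>k<n. input j k \<in> inputs (q j k))"

lemma admissibleD: "admissible n \<Longrightarrow> j \<le> N \<Longrightarrow> k < n \<Longrightarrow> input j k \<in> inputs (q j k)"
  by (simp add: admissible_def)

lemma N_ge_1: "1 \<le> N" and xs_in: "xs \<in> Rd d"
  and smooth_f: "i \<in> {1..N} \<Longrightarrow> smooth d L (f i)"
  and minimizer: "a \<in> Rd d \<Longrightarrow> avg N f xs \<le> avg N f a"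
  using problem by (auto simp: problem_def)

lemma strong: "a \<in> Rd d \<Longrightarrow> b \<in> Rd d \<Longrightarrow>
    avg N f b - avg N f a - (b - a) \<bullet> G a \<ge> \<mu> / 2 * (norm (a - b))\<^sup>2"
  using problem by (simp add: problem_def strongly_convex_def)

lemma smooth_F: "smooth d L (avg N f)"
  using N_ge_1 smooth_f by (rule smooth_avg)

lemma grad_in: "i \<in> {1..N} \<Longrightarrow> a \<in> Rd d \<Longrightarrow> grad d (f i) a \<in> Rd d" and G_in: "a \<in> Rd d \<Longrightarrow> G a \<in> Rd d"
  using smooth_f smooth_F by (auto simp: smooth_def intro: grad_in_Rd)

lemma \<Delta>_nonneg: "0 \<le> \<Delta>"
  unfolding \<Delta> using \<mu>(1) problem by (rule initial_gap_nonneg)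

lemma input_simps:
  "input 0 k = server_input d N f q \<xi> k (st k)"
  "i \<in> {1..N} \<Longrightarrow> input i k = node_input d f (st k) i"
  by (auto simp: deed_input_def Let_def)

text \<open>Index shift: a state stores the node, server and \<open>v\<close> values of the
  preceding iteration, so those of iteration \<open>k\<close> are read from
  \<open>st (Suc k)\<close>.\<close>

lemma st_Suc:
  "st_node (st (Suc k)) i = node_msg d f q \<xi> k (st k) i + st_node (st k) i"
  "st_server (st (Suc k)) = server_sum d N f q \<xi> k (st k)"
  "st_v (st (Suc k)) = server_msg d N f q \<xi> k (st k) + st_v (st k)"
  "st_x (st (Suc k)) = st_y (st k) - (1 / L) *\<^sub>R st_v (st (Suc k))"
  "st_y (st (Suc k)) = st_x (st (Suc k)) + \<tau> *\<^sub>R (st_x (st (Suc k)) - st_x (st k))"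
  by (simp_all add: deed.simps(2) deed_step_def Let_def \<eta>)

section \<open>Quantization errors along a run\<close>

lemma quantize:
  assumes "j \<le> N" "w \<in> inputs (q j k)"
  shows quantize_in: "quantize (q j k) w (\<xi> j k) \<in> Rd d"
    and quantize_error: "norm (quantize (q j k) w (\<xi> j k) - w) \<le> \<epsilon> k"
  using schemes[OF assms(1), of k] assms seeds
  by (auto simp: encoding_scheme_def quantize_def valid_seeds_def)

text \<open>The stored value is subtracted before quantizing and added back after, so it cancels:
  only the current quantization error remains and nothing accumulates.\<close>

lemma node_error:
  assumes "i \<in> {1..N}" "input i k \<in> inputs (q i k)"
  shows "norm (st_node (st (Suc k)) i - grad d (f i) (st_y (st k))) \<le> \<epsilon> k"
  using quantize_error[of i "input i k" k] assms
  by (simp add: st_Suc node_msg_def input_simps node_input_def algebra_simps)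

text \<open>Both sides start at 0 and grow by the mean of the same messages, so the server tracks
  the node averages without seeing any gradient.\<close>

lemma server_mean: "st_server (st k) = (1 / real N) *\<^sub>R (\<Sum>i=1..N. st_node (st k) i)"
  by (induction k) (simp_all only: st_Suc server_sum_def sum.distrib scaleR_add_right, simp)

lemma server_error:
  assumes "\<And>i. i \<in> {1..N} \<Longrightarrow> input i k \<in> inputs (q i k)" "st_y (st k) \<in> Rd d"
  shows "norm (st_server (st (Suc k)) - G (st_y (st k))) \<le> \<epsilon> k"
proof -
  have "G (st_y (st k)) = (1 / real N) *\<^sub>R (\<Sum>i=1..N. grad d (f i) (st_y (st k)))"
    using smooth_f assms(2) by (intro grad_avg) (auto simp: smooth_def)
  then have "st_server (st (Suc k)) - G (st_y (st k))
      = (1 / real N) *\<^sub>R (\<Sum>i=1..N. st_node (st (Suc k)) i - grad d (f i) (st_y (st k)))"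
    by (simp only: server_mean sum_subtractf scaleR_diff_right)
  then show ?thesis
    using norm_mean_le[OF N_ge_1 node_error] assms by simp
qed

lemma v_server_error:
  assumes "input 0 k \<in> inputs (q 0 k)"
  shows "norm (st_v (st (Suc k)) - st_server (st (Suc k))) \<le> \<epsilon> k"
  using quantize_error[of 0 "input 0 k" k] assms
  by (simp add: st_Suc(2,3) server_msg_def input_simps server_input_def algebra_simps)

text \<open>Nodes and server each contribute half of the budget, which explains the 2 in the
  quantization precision.\<close>

lemma v_error:
  assumes "admissible n" "k < n" "st_y (st k) \<in> Rd d"
  shows "norm (st_v (st (Suc k)) - G (st_y (st k))) \<le> s * c' ^ (k + 1)"
  using norm_triangle_ineq[of "st_v (st (Suc k)) - st_server (st (Suc k))"
      "st_server (st (Suc k)) - G (st_y (st k))"]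
    v_server_error[of k] server_error[of k] admissibleD[OF assms(1) _ assms(2)] assms(3)
  by simp

lemma state_in_Rd:
  assumes "admissible n" "k \<le> n"
  shows "st_x (st k) \<in> Rd d \<and> st_y (st k) \<in> Rd d \<and> st_v (st k) \<in> Rd d \<and>
    (\<forall>i\<in>{1..N}. st_node (st k) i \<in> Rd d)"
  using assms(2)
proof (induction k)
  case 0
  then show ?case by (simp add: subspace_0[OF subspace_Rd])
next
  case (Suc k)
  then have IH: "st_x (st k) \<in> Rd d" "st_y (st k) \<in> Rd d" "st_v (st k) \<in> Rd d"
    "\<And>i. i \<in> {1..N} \<Longrightarrow> st_node (st k) i \<in> Rd d" and k: "k < n" by auto
  note Rd = subspace_add[OF subspace_Rd] subspace_diff[OF subspace_Rd] subspace_scale[OF subspace_Rd]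
  have v: "st_v (st (Suc k)) \<in> Rd d"
    using quantize_in[of 0 "input 0 k" k] admissibleD[OF assms(1) _ k, of 0] IH(3)
    by (simp add: st_Suc(3) server_msg_def input_simps Rd(1))
  have x: "st_x (st (Suc k)) \<in> Rd d" unfolding st_Suc(4) by (intro Rd IH v)
  have y: "st_y (st (Suc k)) \<in> Rd d" unfolding st_Suc(5) by (intro Rd IH x)
  have "st_node (st (Suc k)) i \<in> Rd d" if "i \<in> {1..N}" for i
    using quantize_in[of i "input i k" k] admissibleD[OF assms(1) _ k, of i] IH(4) that
    by (simp add: st_Suc(1) node_msg_def input_simps Rd(1))
  with v x y show ?case by blast
qed

section \<open>Convergence rate and distances to the minimizer\<close>

lemma rate:
  assumes "admissible n" "k \<le> n"
  shows "norm (st_x (st k) - xs) \<le> sqrt (2 / \<mu>) * c' ^ k * sqrt (\<Delta> / \<gamma> ^ (2 * k) + C)"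
proof -
  have "\<mu> / 2 * (norm (st_x (st k) - xs))\<^sup>2
    \<le> (c ^ k * sqrt (avg N f (st_x (st 0)) - avg N f xs + \<mu> / 2 * (norm (st_x (st 0) - xs))\<^sup>2)
        + s * c' / (sqrt L * (c' - c)) * c' ^ k)\<^sup>2"
  proof (rule inexact_nesterov[where S = "Rd d" and G = G and v = "\<lambda>k. st_v (st (Suc k))"
        and y = "\<lambda>k. st_y (st k)", OF \<mu> \<tau> c c'(1)])
    show "norm (st_v (st (Suc k)) - G (st_y (st k))) \<le> s * c' ^ (k + 1)" if "k < n" for k
      by (rule v_error[OF assms(1) that]) (use state_in_Rd[OF assms(1), of k] that in simp)
    show "avg N f b - avg N f a - (b - a) \<bullet> G a \<le> L / 2 * (norm (a - b))\<^sup>2"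
      if "a \<in> Rd d" "b \<in> Rd d" for a b
      using smooth_F that unfolding smooth_def by (blast intro: order_trans[OF abs_ge_self])
  qed (use s xs_in G_in strong minimizer state_in_Rd[OF assms(1)] assms(2) in
      \<open>auto simp: st_Suc(4,5) intro: subspace_Rd\<close>)
  then have b: "\<mu> / 2 * (norm (st_x (st k) - xs))\<^sup>2
      \<le> (c ^ k * sqrt \<Delta> + s * c' / (sqrt L * (c' - c)) * c' ^ k)\<^sup>2"
    by (simp add: \<Delta>)
  show ?thesis by (rule rate_constant_bound[OF \<Delta>_nonneg norm_ge_zero b])
qed

lemma rate_const_nonneg: "0 \<le> rate_const"
  using \<Delta>_nonneg C_nonneg \<mu> by (simp add: rate_const_def)

lemma x_dist:
  assumes "admissible n" "k \<le> n"
  shows "norm (st_x (st k) - xs) \<le> rate_const * c' ^ k"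
proof -
  have "\<Delta> / \<gamma> ^ (2 * k) \<le> \<Delta> / 1"
    using \<gamma>_gt_1 \<Delta>_nonneg by (intro divide_left_mono) auto
  then have "sqrt (2 / \<mu>) * c' ^ k * sqrt (\<Delta> / \<gamma> ^ (2 * k) + C) \<le> sqrt (2 / \<mu>) * c' ^ k * sqrt (\<Delta> + C)"
    using \<mu> c'_pos by (intro mult_left_mono) auto
  with rate[OF assms] show ?thesis by (simp add: rate_const_def mult_ac)
qed

text \<open>As \<open>\<tau>\<close> is at most 1, the distance is at most twice that of the current
  \<open>x\<close> plus that of the previous one. The latter carries \<open>c' ^ (k - 1)\<close>,
  whence the division by \<open>c'\<close>.\<close>

lemma y_dist:
  assumes "admissible n" "k \<le> n"
  shows "norm (st_y (st k) - xs) \<le> 3 * rate_const / c' * c' ^ k"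
proof (cases k)
  case 0
  have "rate_const * c' \<le> rate_const * 3" using rate_const_nonneg c'(2) by (intro mult_left_mono) auto
  then have "rate_const \<le> 3 * rate_const / c'" using c'_pos by (simp add: field_simps)
  then show ?thesis using x_dist[OF assms] by (simp add: 0)
next
  case (Suc j)
  then have j: "j \<le> n" using assms(2) by simp
  let ?x = "\<lambda>k. st_x (st k) - xs"
  have "norm (st_y (st k) - xs) = norm (?x k + \<tau> *\<^sub>R (?x k - ?x j))"
    by (simp add: Suc st_Suc(5) algebra_simps)
  also have "\<dots> \<le> norm (?x k) + \<tau> * norm (?x k - ?x j)"
    using \<tau>_bounds by (smt (verit) norm_scaleR norm_triangle_ineq)
  also have "\<dots> \<le> norm (?x k) + 1 * (norm (?x k) + norm (?x j))"
    using \<tau>_bounds by (intro add_mono mult_mono norm_triangle_ineq4) auto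
  also have "\<dots> \<le> rate_const * c' ^ k + 1 * (rate_const * c' ^ k + rate_const * c' ^ j)"
    by (intro add_mono mult_left_mono x_dist[OF assms] x_dist[OF assms(1) j]) auto
  also have "\<dots> = (2 * (rate_const * c') + rate_const) * c' ^ j" by (simp add: Suc algebra_simps)
  also have "\<dots> \<le> (2 * (rate_const * 1) + rate_const) * c' ^ j"
    using rate_const_nonneg c'_pos c'(2) by (intro mult_right_mono add_mono mult_left_mono) auto
  also have "\<dots> = 3 * rate_const / c' * c' ^ k" using c'_pos by (simp add: Suc)
  finally show ?thesis .
qed

section \<open>Bounds on what is quantized\<close>

lemma grad_step:
  assumes "admissible (Suc k)" "smooth d L h"
  shows "norm (grad d h (st_y (st (Suc k))) - grad d h (st_y (st k))) \<le> (input_const - 2 * s) * c' ^ Suc k"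
proof -
  let ?y = "\<lambda>k. st_y (st k)"
  have y: "?y k \<in> Rd d" "?y (Suc k) \<in> Rd d" using state_in_Rd[OF assms(1)] by auto
  have "norm (?y (Suc k) - ?y k) \<le> norm (?y (Suc k) - xs) + norm (?y k - xs)"
    using norm_triangle_ineq4[of "?y (Suc k) - xs" "?y k - xs"] by simp
  also have "\<dots> \<le> 3 * rate_const / c' * c' ^ Suc k + 3 * rate_const / c' * c' ^ k"
    by (intro add_mono y_dist[OF assms(1)]) auto
  also have "\<dots> \<le> 3 * rate_const / c' * c' ^ k + 3 * rate_const / c' * c' ^ k"
    using rate_const_nonneg c'_pos c'(2) by (intro add_mono mult_left_mono) (auto simp: mult_le_cancel_right1)
  finally have "norm (?y (Suc k) - ?y k) \<le> 6 * rate_const / c' * c' ^ k" by (simp add: mult_ac)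
  then have "3 * L * norm (?y (Suc k) - ?y k) \<le> 3 * L * (6 * rate_const / c' * c' ^ k)"
    using L_pos by (intro mult_left_mono) auto
  with grad_Lipschitz[OF assms(2) y] show ?thesis
    using c'_pos by (simp add: input_const_def power2_eq_square)
qed

text \<open>The input splits into the drift of the gradient since the last iteration and the node
  error left from it.\<close>

lemma node_input_bound:
  assumes "admissible (Suc k)" "i \<in> {1..N}"
  shows "norm (input i (Suc k)) \<le> input_const * c' ^ Suc k"
proof -
  let ?g = "\<lambda>k. grad d (f i) (st_y (st k))"
  have "norm (input i (Suc k)) = norm ((?g (Suc k) - ?g k) - (st_node (st (Suc k)) i - ?g k))"
    using assms(2) by (simp add: input_simps node_input_def)
  also have "\<dots> \<le> norm (?g (Suc k) - ?g k) + norm (st_node (st (Suc k)) i - ?g k)"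
    by (rule norm_triangle_ineq4)
  also have "\<dots> \<le> (input_const - 2 * s) * c' ^ Suc k + \<epsilon> k"
    using assms admissibleD[OF assms(1), of i k]
    by (intro add_mono grad_step node_error smooth_f) auto
  also have "\<epsilon> k \<le> 2 * s * c' ^ Suc k" using s c'_pos by simp
  finally show ?thesis by (simp add: left_diff_distrib)
qed

text \<open>The new server value is near the new gradient and the old \<open>v\<close> near the old
  one, so again the gradient drift dominates. The nodes of the same iteration must be in range
  because their messages enter the server input.\<close>

lemma server_input_bound:
  assumes "admissible (Suc k)" "\<And>i. i \<in> {1..N} \<Longrightarrow> input i (Suc k) \<in> inputs (q i (Suc k))"
  shows "norm (input 0 (Suc k)) \<le> input_const * c' ^ Suc k"
proof -
  let ?g = "\<lambda>k. G (st_y (st k))" and ?k = "Suc k"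
  have y: "st_y (st k) \<in> Rd d" "st_y (st ?k) \<in> Rd d" using state_in_Rd[OF assms(1)] by auto
  have "norm (input 0 ?k)
      = norm ((st_server (st (Suc ?k)) - ?g ?k) + (?g ?k - ?g k) - (st_v (st ?k) - ?g k))"
    by (simp add: input_simps server_input_def st_Suc(2))
  also have "\<dots> \<le> norm (st_server (st (Suc ?k)) - ?g ?k) + norm (?g ?k - ?g k) + norm (st_v (st ?k) - ?g k)"
    by (intro order_trans[OF norm_triangle_ineq4] add_right_mono norm_triangle_ineq)
  also have "\<dots> \<le> \<epsilon> ?k + (input_const - 2 * s) * c' ^ ?k + s * c' ^ ?k"
    using v_error[OF assms(1) _ y(1)] assms y
    by (intro add_mono grad_step server_error smooth_F) auto
  \<comment> \<open>The precision of the later iteration has exponent \<open>k + 2\<close>;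
    \<open>c' < 1\<close> brings it down to \<open>k + 1\<close>. Together with the error of
    \<open>v\<close> this uses up the \<open>2 * s\<close> in \<open>input_const\<close>.\<close>
  also have "\<epsilon> ?k \<le> s * c' ^ ?k"
  proof -
    have "s * c' ^ ?k * c' \<le> s * c' ^ ?k * 2"
      using s c'_pos c'(2) by (intro mult_left_mono) auto
    then show ?thesis by (simp add: mult_ac)
  qed
  finally show ?thesis by (simp add: left_diff_distrib)
qed

text \<open>All stored values are 0 at first, so whole gradients at the origin are quantized. Their
  size is not controlled by \<open>input_const\<close>, so iteration 0 has radii of its own.\<close>

lemma input_0_bound:
  shows "i \<in> {1..N} \<Longrightarrow> norm (input i 0) \<le> norm (grad d (f i) 0)"
    and "(\<And>i. i \<in> {1..N} \<Longrightarrow> input i 0 \<in> inputs (q i 0)) \<Longrightarrow>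
      norm (input 0 0) \<le> norm (G 0) + s * c' / 2"
proof -
  show "norm (input i 0) \<le> norm (grad d (f i) 0)" if "i \<in> {1..N}"
    using that by (simp add: input_simps node_input_def)
  assume "\<And>i. i \<in> {1..N} \<Longrightarrow> input i 0 \<in> inputs (q i 0)"
  from server_error[OF this] have "norm (st_server (st (Suc 0)) - G 0) \<le> s * c' / 2"
    by (simp add: subspace_0[OF subspace_Rd])
  moreover have "input 0 0 = st_server (st (Suc 0))"
    by (simp add: input_simps server_input_def st_Suc(2))
  ultimately show "norm (input 0 0) \<le> norm (G 0) + s * c' / 2"
    using norm_triangle_sub[of "st_server (st (Suc 0))" "G 0"] by simp
qed

lemma input_in_Rd:
  assumes "admissible k"
  shows "i \<in> {1..N} \<Longrightarrow> input i k \<in> Rd d"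
    and "(\<And>i. i \<in> {1..N} \<Longrightarrow> input i k \<in> inputs (q i k)) \<Longrightarrow> input 0 k \<in> Rd d"
proof -
  note in_Rd = state_in_Rd[OF assms order_refl]
  show "input i k \<in> Rd d" if "i \<in> {1..N}"
    using that in_Rd by (auto simp: input_simps node_input_def intro!: subspace_diff[OF subspace_Rd] grad_in)
  assume node: "\<And>i. i \<in> {1..N} \<Longrightarrow> input i k \<in> inputs (q i k)"
  have "st_node (st (Suc k)) i \<in> Rd d" if "i \<in> {1..N}" for i
    using quantize_in[of i "input i k" k] node[OF that] in_Rd that
    by (simp add: st_Suc(1) node_msg_def input_simps subspace_add[OF subspace_Rd])
  then have "st_server (st (Suc k)) \<in> Rd d"
    unfolding server_mean by (intro subspace_scale subspace_sum subspace_Rd) auto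
  then show "input 0 k \<in> Rd d"
    using in_Rd by (simp add: input_simps server_input_def st_Suc(2) subspace_diff[OF subspace_Rd])
qed

text \<open>Induction over iterations. In each one the nodes are settled first, on the basis of the
  earlier iterations, and then the server.\<close>

lemma ball_inputs_admissible:
  assumes inputs: "\<And>j k. j \<le> N \<Longrightarrow> inputs (q j k) = {w \<in> Rd d. norm w \<le> M j k}"
    and M_node: "\<And>i. i \<in> {1..N} \<Longrightarrow> norm (grad d (f i) 0) \<le> M i 0"
    and M_server: "norm (G 0) + s * c' / 2 \<le> M 0 0"
    and M_Suc: "\<And>j k. j \<le> N \<Longrightarrow> input_const * c' ^ Suc k \<le> M j (Suc k)"
  shows "admissible n"
proof (induction n)
  case 0
  show ?case by (simp add: admissible_def)
next
  case (Suc n)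
  have node: "input i n \<in> inputs (q i n)" if i: "i \<in> {1..N}" for i
  proof (cases n)
    case 0
    then show ?thesis
      using input_in_Rd(1)[OF Suc i] input_0_bound(1)[OF i] M_node[OF i] inputs[of i n] i by simp
  next
    case (Suc m)
    then show ?thesis
      using input_in_Rd(1)[OF Suc.IH i] node_input_bound[of m i] M_Suc[of i m] inputs[of i n] i Suc.IH
      by simp
  qed
  have "input 0 n \<in> inputs (q 0 n)"
  proof (cases n)
    case 0
    then show ?thesis
      using input_in_Rd(2)[OF Suc node] input_0_bound(2) node M_server inputs[of 0 n] by simp
  next
    case (Suc m)
    then show ?thesis
      using input_in_Rd(2)[OF Suc.IH node] server_input_bound[of m] node M_Suc[of 0 m] inputs[of 0 n] Suc.IH
      by simp
  qed
  with node Suc show ?case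
    by (auto simp: admissible_def less_Suc_eq Suc_le_eq) (metis gr0I)
qed

end

section \<open>Communication cost\<close>

text \<open>Rounding up costs at most 1, hence at most \<open>d\<close>, which turns 1.05 into
  2.05.\<close>

lemma ball_quantizer_bits:
  assumes "ball_quantizer d M \<epsilon> S" "1 \<le> d" "0 \<le> M / \<epsilon>"
  shows "bits S \<le> ennreal ((2.05 + log 2 (2 + M / \<epsilon>)) * real d)"
proof -
  have "of_int \<lceil>1.05 * real d + real d * log 2 (2 + M / \<epsilon>)\<rceil>
      \<le> 1.05 * real d + real d * log 2 (2 + M / \<epsilon>) + 1" by linarith
  also have "\<dots> \<le> (2.05 + log 2 (2 + M / \<epsilon>)) * real d"
    using assms(2) by (simp add: algebra_simps)
  finally show ?thesis
    using assms(1) unfolding ball_quantizer_def by (meson ennreal_leI order_trans)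
qed

lemma iteration_bits_le:
  assumes "\<And>j. j \<le> N \<Longrightarrow> bits (q j k) \<le> ennreal b" "0 \<le> b"
  shows "iteration_bits N q k \<le> ennreal (2 * real N * b)"
proof -
  have "iteration_bits N q k \<le> (\<Sum>i=1..N. ennreal b) + (\<Sum>i=1..N. ennreal b)"
    unfolding iteration_bits_def using assms(1) by (intro add_mono sum_mono) auto
  also have "(\<Sum>i=1..N. ennreal b) = ennreal (real N * b)"
    using sum_ennreal[of "{1..N}" "\<lambda>_. b"] assms(2) by simp
  also have "\<dots> + \<dots> = ennreal (2 * real N * b)"
    using assms(2) by (simp add: ennreal_plus[symmetric] del: ennreal_plus)
  finally show ?thesis .
qed

theorem theorem4p1:
  fixes L \<mu> \<eta> \<tau> c c' s \<gamma> \<Delta> \<alpha>\<^sub>s \<beta>\<^sub>s C :: real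
  assumes "0 < \<mu>" and "\<mu> < L"
    and "\<eta> = 1 / L"
    and "\<tau> = (sqrt L - sqrt \<mu>) / (sqrt L + sqrt \<mu>)"
    and "c = sqrt (1 - sqrt (\<mu> / L))"
    and "c < c'" and "c' < 1" and "0 < s"
    and "\<gamma> = c' / c"
    and "\<alpha>\<^sub>s = s\<^sup>2 / (L * (\<gamma>\<^sup>2 - 1)) + \<Delta>"
    and "\<beta>\<^sub>s = (3 * sqrt (2 / L) + 5 * sqrt (2 / \<mu>)) / (c * (\<gamma>\<^sup>2 - 1)) * s * \<gamma>"
    and "C = \<beta>\<^sub>s\<^sup>2 + \<alpha>\<^sub>s + \<beta>\<^sub>s * sqrt \<alpha>\<^sub>s - \<Delta>"
  shows
    "(\<forall>d N f xs (q :: nat \<Rightarrow> nat \<Rightarrow> 'w scheme) \<xi>.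
        problem d N L \<mu> f xs \<longrightarrow>
        \<Delta> = avg N f 0 - avg N f xs + \<mu> / 2 * (norm (0 - xs))\<^sup>2 \<longrightarrow>
        (\<forall>j\<le>N. \<forall>k. encoding_scheme d (s * c' ^ (k + 1) / 2) (q j k)) \<longrightarrow>
        valid_seeds N q \<xi> \<longrightarrow>
        (\<forall>j\<le>N. \<forall>k. deed_input d N f \<eta> \<tau> q \<xi> j k \<in> inputs (q j k)) \<longrightarrow>
        (\<forall>k. norm (st_x (deed d N f \<eta> \<tau> q \<xi> k) - xs)
               \<le> sqrt (2 / \<mu>) * c' ^ k * sqrt (\<Delta> / \<gamma> ^ (2 * k) + C)))
     \<and>
     (\<exists>K. \<forall>d N f xs (Q :: real \<Rightarrow> real \<Rightarrow> 'w scheme).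
        problem d N L \<mu> f xs \<longrightarrow>
        \<Delta> = avg N f 0 - avg N f xs + \<mu> / 2 * (norm (0 - xs))\<^sup>2 \<longrightarrow>
        (\<forall>M\<ge>0. \<forall>\<epsilon>>0. ball_quantizer d M \<epsilon> (Q M \<epsilon>)) \<longrightarrow>
        (\<exists>M. let q = (\<lambda>j k. Q (M j k) (s * c' ^ (k + 1) / 2)) in
           (\<forall>j\<le>N. \<forall>k. 0 \<le> M j k) \<and>
           (\<forall>\<xi>. valid_seeds N q \<xi> \<longrightarrow>
              (\<forall>j\<le>N. \<forall>k. deed_input d N f \<eta> \<tau> q \<xi> j k \<in> inputs (q j k))) \<and>
           (\<forall>k\<ge>1. iteration_bits N q k \<le> ennreal (K * real N * real d))))"
proof -
  interpret deed_params L \<mu> \<eta> \<tau> c c' s \<gamma> \<Delta> \<alpha>\<^sub>s \<beta>\<^sub>s C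
    by unfold_locales (fact assms)+
  \<comment> \<open>For \<open>k \<ge> 1\<close> radius and precision both scale with
    \<open>c' ^ k\<close>, so \<open>\<rho>\<close> is their ratio at every such iteration. The 2 in
    \<open>K\<close> counts the \<open>N\<close> messages to the server and the \<open>N\<close>
    copies sent back.\<close>
  define \<rho> where "\<rho> = input_const / (s * c' / 2)"
  define K where "K = 2 * (2.05 + log 2 (2 + \<rho>))"
  have \<epsilon>0: "0 < s * c' ^ (k + 1) / 2" for k using s c'_pos by simp
  show ?thesis
  proof (intro conjI exI[of _ K] allI impI)
    fix d N f xs \<xi> k and q :: "nat \<Rightarrow> nat \<Rightarrow> 'w scheme"
    assume "problem d N L \<mu> f xs"
      and "\<Delta> = avg N f 0 - avg N f xs + \<mu> / 2 * (norm (0 - xs))\<^sup>2"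
      and "\<forall>j\<le>N. \<forall>k. encoding_scheme d (s * c' ^ (k + 1) / 2) (q j k)"
      and "valid_seeds N q \<xi>"
      and inputs: "\<forall>j\<le>N. \<forall>k. deed_input d N f \<eta> \<tau> q \<xi> j k \<in> inputs (q j k)"
    then interpret deed_run L \<mu> \<eta> \<tau> c c' s \<gamma> \<Delta> \<alpha>\<^sub>s \<beta>\<^sub>s C d N f xs q \<xi>
      by unfold_locales auto
    show "norm (st_x (deed d N f \<eta> \<tau> q \<xi> k) - xs)
        \<le> sqrt (2 / \<mu>) * c' ^ k * sqrt (\<Delta> / \<gamma> ^ (2 * k) + C)"
      by (rule rate[of k]) (use inputs in \<open>auto simp: admissible_def\<close>)
  next
    fix d N f xs and Q :: "real \<Rightarrow> real \<Rightarrow> 'w scheme"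
    assume prob: "problem d N L \<mu> f xs"
      and \<Delta>: "\<Delta> = avg N f 0 - avg N f xs + \<mu> / 2 * (norm (0 - xs))\<^sup>2"
      and Q: "\<forall>M\<ge>0. \<forall>\<epsilon>>0. ball_quantizer d M \<epsilon> (Q M \<epsilon>)"
    have "0 \<le> \<Delta>" unfolding \<Delta> using assms(1) prob by (rule initial_gap_nonneg)
    then have B0: "0 \<le> input_const" by (rule input_const_nonneg)
    then have \<rho>0: "0 \<le> \<rho>" using s c'_pos by (simp add: \<rho>_def)
    then have log0: "0 \<le> log 2 (2 + \<rho>)" by simp
    \<comment> \<open>The radii must not depend on the seeds. At iteration 0 they come from the
      gradients at the origin, with the mean node error \<open>s * c' / 2\<close> added for the
      server.\<close>
    define M where "M j k = (case k of
        0 \<Rightarrow> if j = 0 then norm (grad d (avg N f) 0) + s * c' / 2 else norm (grad d (f j) 0)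
      | Suc _ \<Rightarrow> input_const * c' ^ k)" for j k :: nat
    define q where "q = (\<lambda>j k. Q (M j k) (s * c' ^ (k + 1) / 2))"
    have M0: "0 \<le> M j k" for j k
      using B0 s c'_pos by (auto simp: M_def split: nat.split)
    have ball: "ball_quantizer d (M j k) (s * c' ^ (k + 1) / 2) (q j k)" for j k
      using Q M0 \<epsilon>0 by (simp add: q_def)
    have "deed_input d N f \<eta> \<tau> q \<xi> j k \<in> inputs (q j k)" if seeds: "valid_seeds N q \<xi>" and "j \<le> N" for \<xi> j k
    proof -
      interpret deed_run L \<mu> \<eta> \<tau> c c' s \<gamma> \<Delta> \<alpha>\<^sub>s \<beta>\<^sub>s C d N f xs q \<xi>
        by unfold_locales (use prob \<Delta> ball seeds in \<open>auto simp: ball_quantizer_def\<close>)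
      have "admissible (Suc k)"
      proof (rule ball_inputs_admissible)
        show "inputs (q j k) = {w \<in> Rd d. norm w \<le> M j k}" for j k
          using ball[of j k] by (simp add: ball_quantizer_def)
      qed (auto simp: M_def)
      then show ?thesis using \<open>j \<le> N\<close> by (rule admissibleD) simp
    qed
    moreover have "iteration_bits N q k \<le> ennreal (K * real N * real d)" if "k \<ge> 1" for k
    proof -
      have "M j k / (s * c' ^ (k + 1) / 2) = \<rho>" for j
        using that c'_pos by (cases k) (simp_all add: M_def \<rho>_def)
      then have "bits (q j k) \<le> ennreal ((2.05 + log 2 (2 + \<rho>)) * real d)" for j
        using ball_quantizer_bits[OF ball[of j k]] prob \<rho>0 by (simp add: problem_def)
      then have "iteration_bits N q k \<le> ennreal (2 * real N * ((2.05 + log 2 (2 + \<rho>)) * real d))"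
        using log0 by (intro iteration_bits_le) auto
      then show ?thesis by (simp add: K_def mult_ac)
    qed
    ultimately show "\<exists>M. let q = (\<lambda>j k. Q (M j k) (s * c' ^ (k + 1) / 2)) in
           (\<forall>j\<le>N. \<forall>k. 0 \<le> M j k) \<and>
           (\<forall>\<xi>. valid_seeds N q \<xi> \<longrightarrow>
              (\<forall>j\<le>N. \<forall>k. deed_input d N f \<eta> \<tau> q \<xi> j k \<in> inputs (q j k))) \<and>
           (\<forall>k\<ge>1. iteration_bits N q k \<le> ennreal (K * real N * real d))"
      using M0 by (intro exI[of _ M]) (simp add: Let_def q_def)
  qed
qed

end
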